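(* For every integer $g$ there exists a nontrivial snark $G$ of girth at least $g$ that contains a pair $\{u,v\}$ of adjacent vertices which is non-removable, i.e. such that the graph $G-\{u,v\}$ is $3$-edge-colourable.
   Context: Graphs are finite; multiple edges and loops are permitted. A snark is a $2$-connected cubic graph that admits no proper $3$-edge-colouring. A cubic graph is cyclically $k$-edge-connected if the removal of fewer than $k$ edges cannot create a graph with at least two components containing circuits. A snark is nontrivial if it is cyclically $4$-edge-connected and has girth at least $5$. An induced subgraph $H$ of a snark $G$ is called non-removable if $G-V(H)$ is $3$-edge-colourable (edge-colourings of graphs with vertices of degree less than $3$ are defined in the usual way: edges sharing a vertex get distinct colours). *)

theory Defs
  imports Main "HOL-Library.Extended_Nat"
begin

text \<open>
  Finite undirected graphs in which loops and parallel edges are allowed: edges are objects of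
  their own, and \<open>ends\<close> gives the set of end-vertices of an edge, a singleton for a loop.
\<close>

record ('v, 'e) multigraph =
  vertices :: "'v set"
  edges :: "'e set"
  ends :: "'e \<Rightarrow> 'v set"

definition finite_multigraph :: "('v, 'e) multigraph \<Rightarrow> bool" where
  "finite_multigraph G \<longleftrightarrow>
     finite (vertices G) \<and> finite (edges G) \<and>
     (\<forall>e\<in>edges G. ends G e \<subseteq> vertices G \<and> card (ends G e) \<in> {1, 2})"

definition adjacent :: "('v, 'e) multigraph \<Rightarrow> 'v \<Rightarrow> 'v \<Rightarrow> bool" where
  "adjacent G u v \<longleftrightarrow> (\<exists>e\<in>edges G. ends G e = {u, v})"

text \<open>The second summand makes a loop contribute two to the degree of its vertex.\<close>

definition degree :: "('v, 'e) multigraph \<Rightarrow> 'v \<Rightarrow> nat" where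
  "degree G v = card {e \<in> edges G. v \<in> ends G e} + card {e \<in> edges G. ends G e = {v}}"

definition cubic :: "('v, 'e) multigraph \<Rightarrow> bool" where
  "cubic G \<longleftrightarrow> (\<forall>v\<in>vertices G. degree G v = 3)"

definition induced :: "('v, 'e) multigraph \<Rightarrow> 'v set \<Rightarrow> ('v, 'e) multigraph" where
  "induced G U = \<lparr>vertices = vertices G \<inter> U, edges = {e \<in> edges G. ends G e \<subseteq> U}, ends = ends G\<rparr>"

definition delete_vertices :: "('v, 'e) multigraph \<Rightarrow> 'v set \<Rightarrow> ('v, 'e) multigraph" where
  "delete_vertices G X = induced G (vertices G - X)"

definition delete_edges :: "('v, 'e) multigraph \<Rightarrow> 'e set \<Rightarrow> ('v, 'e) multigraph" where
  "delete_edges G S = \<lparr>vertices = vertices G, edges = edges G - S, ends = ends G\<rparr>"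

definition joined :: "('v, 'e) multigraph \<Rightarrow> 'v \<Rightarrow> 'v \<Rightarrow> bool" where
  "joined G = (adjacent G)\<^sup>*\<^sup>*"

definition connected_graph :: "('v, 'e) multigraph \<Rightarrow> bool" where
  "connected_graph G \<longleftrightarrow>
     vertices G \<noteq> {} \<and> (\<forall>u\<in>vertices G. \<forall>v\<in>vertices G. joined G u v)"

definition components :: "('v, 'e) multigraph \<Rightarrow> ('v, 'e) multigraph set" where
  "components G = {induced G {w \<in> vertices G. joined G v w} | v. v \<in> vertices G}"

text \<open>Vertex connectivity, as in Diestel's book.\<close>

definition k_connected :: "nat \<Rightarrow> ('v, 'e) multigraph \<Rightarrow> bool" where
  "k_connected k G \<longleftrightarrow>
     k < card (vertices G) \<and>
     (\<forall>X\<subseteq>vertices G. card X < k \<longrightarrow> connected_graph (delete_vertices G X))"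

text \<open>
  A circuit is given by its vertices and edges in cyclic order. A loop is a circuit of length 1
  and two parallel edges form one of length 2; distinctness of the edges prevents a single edge
  traversed back and forth from counting as a circuit of length 2.
\<close>

definition circuit :: "('v, 'e) multigraph \<Rightarrow> 'v list \<Rightarrow> 'e list \<Rightarrow> bool" where
  "circuit G vs es \<longleftrightarrow>
     es \<noteq> [] \<and> length vs = length es \<and> distinct vs \<and> distinct es \<and>
     set vs \<subseteq> vertices G \<and> set es \<subseteq> edges G \<and>
     (\<forall>i<length es. ends G (es ! i) = {vs ! i, vs ! (Suc i mod length es)})"

definition has_circuit :: "('v, 'e) multigraph \<Rightarrow> bool" where
  "has_circuit G \<longleftrightarrow> (\<exists>vs es. circuit G vs es)"

text \<open>The infimum over the empty set is \<open>\<infinity>\<close>, the girth of an acyclic graph.\<close>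

definition girth :: "('v, 'e) multigraph \<Rightarrow> enat" where
  "girth G = Inf {enat (length es) | vs es. circuit G vs es}"

definition cyclically_edge_connected :: "nat \<Rightarrow> ('v, 'e) multigraph \<Rightarrow> bool" where
  "cyclically_edge_connected k G \<longleftrightarrow>
     \<not> (\<exists>S\<subseteq>edges G. card S < k \<and>
          (\<exists>C\<in>components (delete_edges G S). \<exists>D\<in>components (delete_edges G S).
             C \<noteq> D \<and> has_circuit C \<and> has_circuit D))"

text \<open>
  Loops are not constrained by this definition. How they are treated is immaterial for snarks:
  a 2-connected cubic graph has no loops.
\<close>

definition edge_colourable :: "nat \<Rightarrow> ('v, 'e) multigraph \<Rightarrow> bool" where
  "edge_colourable k G \<longleftrightarrow>
     (\<exists>c :: 'e \<Rightarrow> nat.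
        (\<forall>e\<in>edges G. c e < k) \<and>
        (\<forall>e\<in>edges G. \<forall>f\<in>edges G. e \<noteq> f \<and> ends G e \<inter> ends G f \<noteq> {} \<longrightarrow> c e \<noteq> c f))"

definition snark :: "('v, 'e) multigraph \<Rightarrow> bool" where
  "snark G \<longleftrightarrow> finite_multigraph G \<and> k_connected 2 G \<and> cubic G \<and> \<not> edge_colourable 3 G"

definition nontrivial_snark :: "('v, 'e) multigraph \<Rightarrow> bool" where
  "nontrivial_snark G \<longleftrightarrow> snark G \<and> cyclically_edge_connected 4 G \<and> girth G \<ge> 5"

text \<open>The induced subgraph in question is represented by its vertex set.\<close>

definition non_removable :: "('v, 'e) multigraph \<Rightarrow> 'v set \<Rightarrow> bool" where
  "non_removable G U \<longleftrightarrow> U \<subseteq> vertices G \<and> edge_colourable 3 (delete_vertices G U)"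

end

theory Submission
  imports Defs "HOL-Combinatorics.Permutations"
begin

text \<open>
  A 3-edge-colouring is a nowhere-zero flow with values in the group of order four, and
  contracting parts of a graph preserves such flows. So if \<open>B\<close> is a graph without such a flow all
  of whose vertices have degree 3 or 5, then replacing its vertices of degree 5 by arbitrary cubic
  pieces, the bags, gives a cubic graph without 3-edge-colouring. Suppose that the vertices of
  degree 3 of \<open>B\<close> induce a forest. Then every cycle lies in a bag or passes through a bag from one
  of its five exits to another. Hence the girth is large if each bag is a cubic graph of large
  girth minus a path with three vertices.

  The graph \<open>B\<close> is a repeated superposition of the Petersen graph \<open>P\<close>. Removing three suitable
  vertices \<open>x\<close>, \<open>y\<close>, \<open>z\<close> from \<open>P\<close> leaves a tree, and in every flow on this tree the flows out of
  the places of \<open>x\<close>, \<open>y\<close>, \<open>z\<close> are not all zero. Removing the ends of two suitable edges from \<open>P\<close> also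
  leaves a tree; put a copy of the first tree, with its connectors at \<open>x\<close> and \<open>y\<close>, in place of each of
  the two edges. If the flow out of one of the two places of \<open>z\<close> vanished, then so would the other,
  and both edges would carry non-zero flow, contradicting that \<open>P\<close> has no nowhere-zero flow. So the
  two places of \<open>z\<close> are the ends of a superedge that always carries non-zero flow. Putting two such
  superedges in place of the same two edges of a further copy of \<open>P\<close> gives \<open>B\<close>.

  For the connectivity, the cubic graph of large girth is a Cayley graph, in which cuts with at
  most five edges are trivial, and the vertices of degree 5 of \<open>B\<close> are joined by four edge-disjoint
  paths.
\<close>

section \<open>Cuts and cycles of symmetric relations\<close>

text \<open>For symmetric \<open>E\<close> each undirected edge between \<open>X\<close> and the
  rest is counted once, in its outward direction.\<close>

definition cut :: "('a \<times> 'a) set \<Rightarrow> 'a set \<Rightarrow> nat" where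
  "cut E X = card (E \<inter> X \<times> (-X))"

lemma cut_submodular:
  assumes "finite E"
  shows "cut E (X \<inter> Y) + cut E (X \<union> Y) \<le> cut E X + cut E Y"
proof -
  let ?A = "E \<inter> (X \<inter> Y) \<times> (-(X \<inter> Y))" and ?B = "E \<inter> (X \<union> Y) \<times> (-(X \<union> Y))"
  let ?C = "E \<inter> X \<times> (-X)" and ?D = "E \<inter> Y \<times> (-Y)"
  have "card ?A + card ?B = card (?A \<union> ?B) + card (?A \<inter> ?B)"
    using assms by (intro card_Un_Int) auto
  also have "\<dots> \<le> card (?C \<union> ?D) + card (?C \<inter> ?D)"
    using assms by (intro add_mono card_mono) auto
  also have "\<dots> = card ?C + card ?D"
    using assms by (intro card_Un_Int[symmetric]) auto
  finally show ?thesis by (simp add: cut_def)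
qed

lemma cut_complement:
  assumes "E \<subseteq> V \<times> V" "sym E" "X \<subseteq> V"
  shows "cut E (V - X) = cut E X"
proof -
  have "bij_betw (\<lambda>(x, y). (y, x)) (E \<inter> (V - X) \<times> (-(V - X))) (E \<inter> X \<times> (-X))"
    by (rule bij_betw_byWitness[where f' = "\<lambda>(x, y). (y, x)"])
       (use assms in \<open>auto simp: sym_def\<close>)
  then show ?thesis unfolding cut_def by (rule bij_betw_same_card)
qed

text \<open>The intersection of \<open>X\<close> and \<open>V - Y\<close> is \<open>X - Y\<close>
  and their union is the complement of \<open>Y - X\<close>, so this is submodularity after
  complementation.\<close>

lemma cut_posimodular:
  assumes "finite E" "E \<subseteq> V \<times> V" "sym E" "X \<subseteq> V" "Y \<subseteq> V"
  shows "cut E (X - Y) + cut E (Y - X) \<le> cut E X + cut E Y"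
proof -
  have "X \<inter> (V - Y) = X - Y" "X \<union> (V - Y) = V - (Y - X)"
    using assms by auto
  then show ?thesis
    using cut_submodular[OF assms(1), of X "V - Y"] cut_complement[OF assms(2,3)] assms(4,5)
    by (metis Diff_subset order.trans)
qed

lemma cut_sum:
  assumes "finite X" "finite E"
  shows "cut E X = (\<Sum>x\<in>X. card (E `` {x} - X))"
proof -
  have "E \<inter> X \<times> (-X) = (SIGMA x:X. E `` {x} - X)" by auto
  then show ?thesis using assms by (simp add: cut_def finite_Image)
qed

text \<open>The length bound keeps an edge traversed back and forth from being a cycle.\<close>

definition cycle_list :: "('a \<times> 'a) set \<Rightarrow> 'a list \<Rightarrow> bool" where
  "cycle_list E xs \<longleftrightarrow> 3 \<le> length xs \<and> distinct xs \<and>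
     successively (\<lambda>x y. (x, y) \<in> E) xs \<and> (last xs, hd xs) \<in> E"

text \<open>The first vertex of a longest path in \<open>Y\<close> has all its neighbours in
  \<open>Y\<close> on that path. A neighbour other than its successor closes a cycle.\<close>

lemma exists_cycle_list:
  assumes fin: "finite Y" and ne: "Y \<noteq> {}" and "sym E" and irr: "\<And>x. (x, x) \<notin> E"
    and deg: "\<And>y. y \<in> Y \<Longrightarrow> 2 \<le> card (E `` {y} \<inter> Y)"
  shows "\<exists>xs. cycle_list E xs \<and> set xs \<subseteq> Y"
proof -
  define P where "P xs \<longleftrightarrow> xs \<noteq> [] \<and> distinct xs \<and> set xs \<subseteq> Y \<and>
    successively (\<lambda>x y. (x, y) \<in> E) xs" for xs
  obtain y where "y \<in> Y" using ne by auto
  then have "P [y]" by (simp add: P_def)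
  moreover have "length xs \<le> card Y" if "P xs" for xs
    using that fin unfolding P_def by (metis card_mono distinct_card)
  ultimately obtain xs where xs: "P xs" and mx: "\<And>ys. P ys \<Longrightarrow> length ys \<le> length xs"
    using ex_has_greatest_nat[of P "[y]" length "Suc (card Y)"] by (auto simp: less_Suc_eq_le)
  then obtain x zs where xz: "xs = x # zs" by (cases xs) (auto simp: P_def)
  have xY: "x \<in> Y" using xs xz by (auto simp: P_def)
  have nb: "E `` {x} \<inter> Y \<subseteq> set zs"
  proof
    fix w assume w: "w \<in> E `` {x} \<inter> Y"
    have "w \<in> set xs"
    proof (rule ccontr)
      assume "w \<notin> set xs"
      then have "P (w # xs)"
        using xs xz w \<open>sym E\<close> by (auto simp: P_def successively_Cons sym_def)
      then show False using mx by fastforce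
    qed
    then show "w \<in> set zs" using w irr xz by auto
  qed
  have "\<exists>w. w \<in> E `` {x} \<inter> Y \<and> w \<noteq> hd zs"
  proof (rule ccontr)
    assume "\<not> ?thesis"
    then have "E `` {x} \<inter> Y \<subseteq> {hd zs}" by auto
    then have "card (E `` {x} \<inter> Y) \<le> 1" using card_mono[of "{hd zs}"] by simp
    then show False using deg[OF xY] by simp
  qed
  then obtain w where w: "w \<in> E `` {x} \<inter> Y" "w \<noteq> hd zs" by auto
  then obtain us vs where uv: "zs = us @ w # vs" using nb split_list by fastforce
  then have us: "us \<noteq> []" using w by auto
  have eq: "xs = (x # us @ [w]) @ vs" using xz uv by simp
  have "cycle_list E (x # us @ [w])"
    unfolding cycle_list_def
  proof (intro conjI)
    show "3 \<le> length (x # us @ [w])" using us by (cases us) auto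
    show "distinct (x # us @ [w])" using xs eq by (auto simp: P_def)
    show "successively (\<lambda>x y. (x, y) \<in> E) (x # us @ [w])"
      using xs unfolding P_def eq successively_append_iff by blast
    show "(last (x # us @ [w]), hd (x # us @ [w])) \<in> E"
      using w \<open>sym E\<close> by (auto simp: sym_def)
  qed
  moreover have "set (x # us @ [w]) \<subseteq> Y" using xs eq by (auto simp: P_def)
  ultimately show ?thesis by blast
qed

text \<open>The host graphs and the final graphs are simple, so a symmetric relation suffices until
  \<open>relation_graph\<close> passes to multigraphs.\<close>

locale cubic_relation =
  fixes V :: "'a set" and E :: "('a \<times> 'a) set"
  assumes finV: "finite V" and EV: "E \<subseteq> V \<times> V" and symE: "sym E"
    and irrE: "(x, x) \<notin> E" and deg3: "x \<in> V \<Longrightarrow> card (E `` {x}) = 3"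
begin

lemma finE: "finite E"
  using finV EV finite_subset by blast

lemma E_sym: "(x, y) \<in> E \<Longrightarrow> (y, x) \<in> E"
  using symE by (auto simp: sym_def)

text \<open>A set of at most \<open>L\<close> vertices induces a forest. In a cubic graph, a forest
  with \<open>k\<close> vertices and \<open>c\<close> components has
  \<open>3 k - 2 (k - c) = k + 2 c\<close> outgoing edges. The induction removes vertices with at
  most one neighbour in the set.\<close>

lemma cut_ge_of_no_short_cycles:
  assumes nc: "\<And>xs. cycle_list E xs \<Longrightarrow> L < length xs"
    and "Y \<subseteq> V" "Y \<noteq> {}" "card Y \<le> L"
  shows "card Y + 2 \<le> cut E Y"
  using assms(2-4)
proof (induction "card Y" arbitrary: Y rule: less_induct)
  case less
  have fY: "finite Y" using less.prems finV finite_subset by blast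
  have "\<exists>y\<in>Y. card (E `` {y} \<inter> Y) < 2"
  proof (rule ccontr)
    assume "\<not> ?thesis"
    then obtain xs where xs: "cycle_list E xs" "set xs \<subseteq> Y"
      using exists_cycle_list[OF fY less.prems(2) symE irrE] by (auto simp: not_less)
    then have "length xs \<le> card Y"
      using fY by (metis card_mono cycle_list_def distinct_card)
    then show False using nc[OF xs(1)] less.prems by simp
  qed
  then obtain y where y: "y \<in> Y" "card (E `` {y} \<inter> Y) < 2" by auto
  define Z where "Z = Y - {y}"
  have fE: "finite (E `` {y})" using finE by (rule finite_Image)
  have d: "card (E `` {y} - Y) + card (E `` {y} \<inter> Y) = 3"
    using deg3[of y] y less.prems card_Int_Diff[OF fE, of Y] by auto
  \<comment> \<open>Taking \<open>y\<close> out loses its edges leaving \<open>Y\<close>, at least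
    two in number, and gains at most one edge to a neighbour inside \<open>Y\<close>, so the cut
    shrinks.\<close>
  have ZY: "E \<inter> Z \<times> (-Z) \<subseteq> (E \<inter> Y \<times> (-Y) - {y} \<times> (E `` {y} - Y)) \<union> (\<lambda>z. (z, y)) ` (E `` {y} \<inter> Y)"
    using E_sym by (auto simp: Z_def)
  have sub: "{y} \<times> (E `` {y} - Y) \<subseteq> E \<inter> Y \<times> (-Y)" using y by auto
  have "cut E Z \<le> card (E \<inter> Y \<times> (-Y) - {y} \<times> (E `` {y} - Y)) + card ((\<lambda>z. (z, y)) ` (E `` {y} \<inter> Y))"
    unfolding cut_def using card_mono[OF _ ZY] finE fE card_Un_le
    by (meson finite_Diff finite_Int finite_UnI finite_imageI order.trans)
  also have "\<dots> \<le> (cut E Y - card (E `` {y} - Y)) + card (E `` {y} \<inter> Y)"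
    using finE fE sub by (intro add_mono) (auto simp: cut_def card_Diff_subset card_image_le)
  finally have c: "cut E Z \<le> (cut E Y - card (E `` {y} - Y)) + card (E `` {y} \<inter> Y)" .
  have cY: "card (E `` {y} - Y) \<le> cut E Y"
    unfolding cut_def using card_mono[OF _ sub] finE by (simp add: card_cartesian_product_singleton)
  show ?case
  proof (cases "Z = {}")
    case True
    then have "Y = {y}" using y Z_def by auto
    moreover have "E `` {y} \<inter> {y} = {}" using irrE by auto
    ultimately show ?thesis using cY d by simp
  next
    case False
    have cZ: "card Y = Suc (card Z)" using card_Suc_Diff1[OF fY y(1)] by (simp add: Z_def)
    have "card Z + 2 \<le> cut E Z" using less.hyps[of Z] False cZ less.prems by (auto simp: Z_def)
    then show ?thesis using c cY d y(2) cZ by linarith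
  qed
qed

end

section \<open>Small cuts in vertex-transitive cubic graphs\<close>

locale transitive_cubic = cubic_relation +
  assumes trans: "\<lbrakk>x \<in> V; y \<in> V\<rbrakk> \<Longrightarrow>
      \<exists>f. bij_betw f V V \<and> f x = y \<and> (\<forall>u\<in>V. \<forall>v\<in>V. (f u, f v) \<in> E \<longleftrightarrow> (u, v) \<in> E)"
    and conn: "\<lbrakk>Y \<subseteq> V; Y \<noteq> {}; Y \<noteq> V\<rbrakk> \<Longrightarrow> 0 < cut E Y"
    and girth6: "cycle_list E xs \<Longrightarrow> 6 < length xs"
begin

lemma outdegree_automorphism:
  assumes f: "bij_betw f V V" "\<forall>u\<in>V. \<forall>v\<in>V. (f u, f v) \<in> E \<longleftrightarrow> (u, v) \<in> E"
    and A: "A \<subseteq> V" "a \<in> A"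
  shows "card (E `` {f a} - f ` A) = card (E `` {a} - A)"
proof -
  have "f ` (E `` {a} - A) = E `` {f a} - f ` A"
  proof (rule set_eqI iffI)+
    fix y assume "y \<in> f ` (E `` {a} - A)"
    then obtain x where x: "y = f x" "(a, x) \<in> E" "x \<notin> A" by auto
    have xa: "x \<in> V" "a \<in> V" using x EV by auto
    have "f x \<notin> f ` A"
      using inj_on_image_mem_iff[of f V x A] f(1) xa x(3) A(1) by (simp add: bij_betw_def)
    moreover have "(f a, f x) \<in> E" using f(2) xa x(2) by blast
    ultimately show "y \<in> E `` {f a} - f ` A" using x(1) by simp
  next
    fix y assume y: "y \<in> E `` {f a} - f ` A"
    then have "y \<in> V" using EV by auto
    then obtain x where x: "x \<in> V" "y = f x" using f(1) by (auto simp: bij_betw_def)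
    moreover have "x \<in> E `` {a} - A" using y x f(2) A by blast
    ultimately show "y \<in> f ` (E `` {a} - A)" by blast
  qed
  moreover have "inj_on f (E `` {a} - A)"
    using f(1) EV by (auto simp: bij_betw_def intro: inj_on_subset)
  ultimately show ?thesis using card_image by metis
qed

lemma cut_automorphism:
  assumes f: "bij_betw f V V" "\<forall>u\<in>V. \<forall>v\<in>V. (f u, f v) \<in> E \<longleftrightarrow> (u, v) \<in> E"
    and A: "A \<subseteq> V"
  shows "cut E (f ` A) = cut E A"
proof -
  have i: "inj_on f A" using f A by (auto simp: bij_betw_def intro: inj_on_subset)
  have "finite A" using A finV finite_subset by auto
  then show ?thesis
    using outdegree_automorphism[OF f A] i finE by (simp add: cut_sum sum.reindex)
qed

text \<open>
  Uncrossing: a smallest counterexample side is disjoint from, or equal to, each of its images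
  under automorphisms, so all its vertices send the same positive number of edges out of it.
\<close>

theorem small_side_of_cut:
  assumes "Y \<subseteq> V" "cut E Y \<le> 5"
  shows "card Y \<le> 3 \<or> card (V - Y) \<le> 3"
proof (rule ccontr)
  assume neg: "\<not> ?thesis"
  define big where "big X \<longleftrightarrow> X \<subseteq> V \<and> 4 \<le> card X \<and> 4 \<le> card (V - X)" for X
  have bigY: "big Y" using neg assms by (simp add: big_def)
  \<comment> \<open>\<open>B\<close> has the smallest cut among the sets with at least four vertices
    on either side, and \<open>A\<close> is a smallest set among those attaining it.\<close>
  obtain B where B: "big B" and Bmin: "\<And>X. big X \<Longrightarrow> cut E B \<le> cut E X"
    using ex_has_least_nat[of big Y "cut E"] bigY by blast
  obtain A where A: "big A" "cut E A = cut E B"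
    and Amin: "\<And>X. big X \<Longrightarrow> cut E X = cut E B \<Longrightarrow> card A \<le> card X"
    using ex_has_least_nat[of "\<lambda>X. big X \<and> cut E X = cut E B" B card] B by blast
  have AV: "A \<subseteq> V" and fA: "finite A" using A finV finite_subset by (auto simp: big_def)
  have k5: "cut E A \<le> 5" using A Bmin[OF bigY] assms by simp
  \<comment> \<open>Sets of four to six vertices induce forests, as cycles have more than six
    vertices, and so their cuts have at least six edges.\<close>
  have A7: "7 \<le> card A"
  proof (rule ccontr)
    assume "\<not> 7 \<le> card A"
    then have "card A + 2 \<le> cut E A"
      using A by (intro cut_ge_of_no_short_cycles[of 6]) (auto simp: big_def girth6)
    then show False using k5 A by (simp add: big_def)
  qed
  have "big (V - A)" using A by (auto simp: big_def double_diff)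
  then have Ahalf: "card A \<le> card (V - A)"
    using Amin cut_complement[OF EV symE AV] A by metis
  have cardV: "card V = card A + card (V - A)"
    using finV AV by (metis card_Diff_subset card_mono fA le_add_diff_inverse)
  have block: "f ` A = A"
    if f: "bij_betw f V V" "\<forall>u\<in>V. \<forall>v\<in>V. (f u, f v) \<in> E \<longleftrightarrow> (u, v) \<in> E"
      and meet: "A \<inter> f ` A \<noteq> {}" for f
  proof (rule ccontr)
    assume ne: "f ` A \<noteq> A"
    define A' where "A' = f ` A"
    have A'V: "A' \<subseteq> V" using f(1) AV by (auto simp: A'_def bij_betw_def)
    have fA': "finite A'" using fA by (simp add: A'_def)
    have cA': "card A' = card A"
      unfolding A'_def using f(1) AV by (intro card_image) (auto simp: bij_betw_def intro: inj_on_subset)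
    have kA': "cut E A' = cut E A" unfolding A'_def by (rule cut_automorphism[OF f AV])
    have notsub: "\<not> A \<subseteq> A'"
      using ne cA' fA' by (metis A'_def card_subset_eq)
    have split: "card (A \<inter> A') + card (A - A') = card A"
      using fA card_Int_Diff[of A A'] by simp
    have split': "card (A \<inter> A') + card (A' - A) = card A'"
      using fA' card_Int_Diff[of A' A] by (simp add: Int_commute)
    have lt: "card (A \<inter> A') < card A"
      using notsub fA by (intro psubset_card_mono) auto
    have pos: "0 < card (A \<inter> A')" using meet fA by (simp add: A'_def card_gt_0_iff)
    have sup: "card (V - A) \<le> card (V - X)" if "X \<subseteq> A" for X
      using that finV by (intro card_mono) auto
    have sup': "card (V - A') \<le> card (V - X)" if "X \<subseteq> A'" for X
      using that finV by (intro card_mono) auto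
    have cVA': "card (V - A') = card (V - A)"
      using finV AV A'V cA' fA fA' by (simp add: card_Diff_subset)
    \<comment> \<open>If the overlap is large, union and intersection are both admissible, and by
      submodularity the intersection is a smaller minimiser. Otherwise each difference keeps at
      least 7 - 3 = 4 vertices, and posimodularity yields a smaller minimiser.\<close>
    show False
    proof (cases "4 \<le> card (A \<inter> A')")
      case True
      have un: "card (A \<union> A') + card (A \<inter> A') = 2 * card A"
        using card_Un_Int[OF fA fA'] cA' by simp
      have "card (V - (A \<union> A')) + card (A \<union> A') = card V"
        using finV AV A'V fA fA' by (metis Un_subset_iff add.commute card_Diff_subset card_mono finite_UnI le_add_diff_inverse)
      then have "card (A \<inter> A') \<le> card (V - (A \<union> A'))"
        using un cardV Ahalf by linarith
      then have b1: "big (A \<union> A')"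
        using True AV A'V A7 fA fA' by (auto simp: big_def intro: order.trans[OF _ card_mono[of _ A]])
      have b2: "big (A \<inter> A')"
        using True AV A sup[of "A \<inter> A'"] by (auto simp: big_def)
      have "cut E (A \<inter> A') = cut E B"
        using cut_submodular[OF finE, of A A'] Bmin[OF b1] Bmin[OF b2] kA' A(2) by simp
      then show False using Amin[OF b2] lt by simp
    next
      case False
      have b1: "big (A - A')"
        using False split A7 sup[of "A - A'"] A AV by (auto simp: big_def)
      have b2: "big (A' - A)"
        using False split' cA' A7 sup'[of "A' - A"] cVA' A A'V by (auto simp: big_def)
      have "cut E (A - A') = cut E B"
        using cut_posimodular[OF finE EV symE AV A'V] Bmin[OF b1] Bmin[OF b2] kA' A(2) by simp
      then show False using Amin[OF b1] split pos by simp
    qed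
  qed
  obtain a where a: "a \<in> A" using A7 by fastforce
  have const: "card (E `` {b} - A) = card (E `` {a} - A)" if b: "b \<in> A" for b
  proof -
    obtain f where f: "bij_betw f V V" "\<forall>u\<in>V. \<forall>v\<in>V. (f u, f v) \<in> E \<longleftrightarrow> (u, v) \<in> E" "f a = b"
      using trans[of a b] a b AV by blast
    have "f ` A = A" using block[OF f(1,2)] f(3) a b by blast
    then show ?thesis using outdegree_automorphism[OF f(1,2) AV a] f(3) by simp
  qed
  have "A \<noteq> V" using A by (auto simp: big_def)
  then have "0 < cut E A" using conn[OF AV] a by blast
  \<comment> \<open>Equal positive contributions of all vertices force at least
    \<open>card A\<close> edges, while \<open>card A\<close> is at least seven and the cut has at
    most five.\<close>
  moreover have "cut E A = card A * card (E `` {a} - A)"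
    using const by (simp add: cut_sum[OF fA finE])
  ultimately have "card A \<le> cut E A" by simp
  then show False using A7 k5 by simp
qed

end

section \<open>Vertex-transitive cubic graphs of large girth\<close>

lemma successively_nth:
  "successively P xs \<Longrightarrow> Suc k < length xs \<Longrightarrow> P (xs ! k) (xs ! Suc k)"
  by (induction P xs arbitrary: k rule: successively.induct) (auto simp: nth_Cons split: nat.splits)

lemma successively_nthI:
  "(\<And>k. Suc k < length xs \<Longrightarrow> P (xs ! k) (xs ! Suc k)) \<Longrightarrow> successively P xs"
proof (induction xs)
  case (Cons x xs)
  have "successively P xs" using Cons.prems[of "Suc _"] by (intro Cons.IH) auto
  moreover have "P x (hd xs)" if "xs \<noteq> []" using Cons.prems[of 0] that by (auto simp: hd_conv_nth)
  ultimately show ?case by (auto simp: successively_Cons)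
qed simp

lemma cycle_list_nth:
  assumes "cycle_list E xs"
  shows "(xs ! (k mod length xs), xs ! (Suc k mod length xs)) \<in> E"
proof -
  have m: "3 \<le> length xs" and s: "successively (\<lambda>x y. (x, y) \<in> E) xs" and l: "(last xs, hd xs) \<in> E"
    using assms by (auto simp: cycle_list_def)
  have ne: "xs \<noteq> []" using m by auto
  show ?thesis
  proof (cases "Suc (k mod length xs) < length xs")
    case True
    then show ?thesis using successively_nth[OF s True] by (simp add: mod_Suc)
  next
    case False
    then have "k mod length xs = length xs - 1"
      using mod_less_divisor[of "length xs" k] m by linarith
    then show ?thesis using l ne by (simp add: mod_Suc last_conv_nth hd_conv_nth)
  qed
qed

text \<open>
  The involutions below act on the ball of radius \<open>r\<close> in the 3-regular tree, whose vertices are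
  the reduced words over three letters. In the Cayley graph of the group that they generate, a
  closed reduced walk of length at most \<open>r\<close> would move the centre of the ball and not move it.
\<close>

definition tree_ball :: "nat \<Rightarrow> nat list set" where
  "tree_ball r = {w. set w \<subseteq> {..<3} \<and> length w \<le> r \<and> distinct_adj w}"

text \<open>Left multiplication by a generator of the free product of three groups of order two. A
  word of full length that would leave the ball is fixed instead, which keeps the map an involution
  of a finite set.\<close>

definition reflect :: "nat \<Rightarrow> nat \<Rightarrow> nat list \<Rightarrow> nat list" where
  "reflect r i w =
     (if w \<notin> tree_ball r then w
      else if w \<noteq> [] \<and> hd w = i then tl w
      else if length w < r then i # w else w)"

lemma distinct_adj_Cons': "distinct_adj (i # w) \<longleftrightarrow> (w = [] \<or> i \<noteq> hd w) \<and> distinct_adj w"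
  by (cases w) auto

lemma reflect_in: "i < 3 \<Longrightarrow> w \<in> tree_ball r \<Longrightarrow> reflect r i w \<in> tree_ball r"
  by (cases w) (auto simp: reflect_def tree_ball_def distinct_adj_Cons')

lemma reflect_reflect:
  assumes "i < 3"
  shows "reflect r i (reflect r i w) = w"
proof (cases "w \<in> tree_ball r")
  case True
  then show ?thesis
    using assms by (cases w) (auto simp: reflect_def tree_ball_def distinct_adj_Cons')
qed (auto simp: reflect_def)

lemma reflect_permutes: "i < 3 \<Longrightarrow> reflect r i permutes tree_ball r"
  by (rule bij_imp_permutes)
     (auto intro!: bij_betw_byWitness[where f' = "reflect r i"] simp: reflect_reflect reflect_in,
      simp add: reflect_def)

lemma finite_tree_ball: "finite (tree_ball r)"
  by (rule finite_subset[OF _ finite_lists_length_le[of "{..<3}" r]]) (auto simp: tree_ball_def)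

text \<open>Closing under left multiplication by the generators already gives a group, because they
  are involutions.\<close>

inductive_set reflection_group :: "nat \<Rightarrow> (nat list \<Rightarrow> nat list) set" for r where
  id_in: "id \<in> reflection_group r"
| step_in: "x \<in> reflection_group r \<Longrightarrow> i < 3 \<Longrightarrow> reflect r i \<circ> x \<in> reflection_group r"

lemma reflection_group_permutes: "x \<in> reflection_group r \<Longrightarrow> x permutes tree_ball r"
  by (induction rule: reflection_group.induct) (blast intro: permutes_compose reflect_permutes permutes_id)+

lemma reflection_group_comp:
  "x \<in> reflection_group r \<Longrightarrow> y \<in> reflection_group r \<Longrightarrow> x \<circ> y \<in> reflection_group r"
  by (induction rule: reflection_group.induct) (auto simp: comp_assoc intro: reflection_group.intros)

lemma reflection_group_inv:
  "x \<in> reflection_group r \<Longrightarrow> inv x \<in> reflection_group r"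
proof (induction rule: reflection_group.induct)
  case id_in
  then show ?case by (auto intro: reflection_group.id_in simp: id_def[symmetric])
next
  case (step_in x i)
  have "bij (reflect r i)" "bij x"
    using reflect_permutes reflection_group_permutes step_in permutes_bij by blast+
  then have "inv (reflect r i \<circ> x) = inv x \<circ> inv (reflect r i)" by (rule o_inv_distrib)
  moreover have "inv (reflect r i) = reflect r i"
    using step_in reflect_reflect by (intro inv_unique_comp) (auto simp: fun_eq_iff)
  moreover have "reflect r i \<in> reflection_group r"
    using reflection_group.step_in[OF reflection_group.id_in step_in(2)] by simp
  ultimately show ?case using reflection_group_comp[OF step_in(3)] by metis
qed

text \<open>In a Cayley graph for three involutions, \<open>n i x\<close> is the neighbour of
  \<open>x\<close> along the edge labelled with generator \<open>i\<close>. The labels form a proper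
  3-edge-colouring, which later serves inside the bags.\<close>

locale coloured_host = transitive_cubic +
  fixes n :: "nat \<Rightarrow> 'a \<Rightarrow> 'a" and L :: nat
  assumes V_ne: "V \<noteq> {}"
    and E_eq: "E = {(x, n i x) | x i. x \<in> V \<and> i < 3}"
    and n_inv: "\<lbrakk>x \<in> V; i < 3\<rbrakk> \<Longrightarrow> n i (n i x) = x"
    and n_inj: "\<lbrakk>x \<in> V; i < 3; j < 3; n i x = n j x\<rbrakk> \<Longrightarrow> i = j"
    and girthL: "cycle_list E xs \<Longrightarrow> L < length xs"

theorem coloured_host_exists:
  "\<exists>V E n. coloured_host (V :: (nat list \<Rightarrow> nat list) set) E n L"
proof -
  \<comment> \<open>Large enough for all cycles to be longer than both \<open>L\<close> and
    6.\<close>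
  define r where "r = L + 6"
  define V where "V = reflection_group r"
  define n where "n = (\<lambda>i (x :: nat list \<Rightarrow> nat list). reflect r i \<circ> x)"
  define E where "E = {(x, n i x) | x i. x \<in> V \<and> i < 3}"
  have bij: "bij x" if "x \<in> V" for x
    using that reflection_group_permutes permutes_bij unfolding V_def by blast
  have n_in: "n i x \<in> V" if "x \<in> V" "i < 3" for i x
    using that by (auto simp: V_def n_def intro: reflection_group.intros)
  have n_inv: "n i (n i x) = x" if "i < 3" for i x
    using that by (auto simp: n_def fun_eq_iff reflect_reflect)
  have refl0: "reflect r i [] = [i]" for i
    by (auto simp: reflect_def tree_ball_def r_def)
  \<comment> \<open>Some point is carried to the centre of the ball, where the three generators act
    differently and none acts trivially.\<close>
  have moved: "\<exists>q. x q = []" if "x \<in> V" for x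
    using bij[OF that] by (metis bij_pointE)
  have n_inj: "i = j" if x: "x \<in> V" "n i x = n j x" for x i j
  proof -
    obtain q where "x q = []" using moved x by blast
    then show ?thesis using fun_cong[OF x(2), of q] refl0 by (simp add: n_def)
  qed
  have n_neq: "n i x \<noteq> x" if x: "x \<in> V" for x i
  proof
    assume a: "n i x = x"
    obtain q where "x q = []" using moved x by blast
    then show False using fun_cong[OF a, of q] refl0[of i] by (simp add: n_def)
  qed
  have girth: "r < length xs" if c: "cycle_list E xs" for xs
  proof (rule ccontr)
    assume "\<not> r < length xs"
    then have mr: "length xs \<le> r" by simp
    define m where "m = length xs"
    define X where "X k = xs ! (k mod m)" for k
    have m3: "3 \<le> m" and dist: "distinct xs" using c by (auto simp: cycle_list_def m_def)
    have XE: "(X k, X (Suc k)) \<in> E" for k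
      using cycle_list_nth[OF c] by (simp add: X_def m_def)
    then have "\<forall>k. \<exists>i<3. X (Suc k) = n i (X k)" by (auto simp: E_def)
    then obtain col where col: "\<And>k. col k < 3" "\<And>k. X (Suc k) = n (col k) (X k)" by metis
    have XV: "X k \<in> V" for k using XE[of k] by (auto simp: E_def)
    obtain q where q: "X 0 q = []" using moved[OF XV] by blast
    \<comment> \<open>Follow the preimage \<open>q\<close> of the centre along the cycle. Each step
      prepends the colour of the edge just used, because successive colours differ and the ball has
      room for \<open>m\<close> letters. So \<open>q\<close> is not back at the centre after
      \<open>m\<close> steps.\<close>
    have "length (X k q) = k \<and> set (X k q) \<subseteq> {..<3} \<and> distinct_adj (X k q) \<and>
        (0 < k \<longrightarrow> hd (X k q) = col (k - 1))" if "k \<le> m" for k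
      using that
    proof (induction k)
      case 0
      then show ?case using q by simp
    next
      case (Suc k)
      then have IH: "length (X k q) = k" "set (X k q) \<subseteq> {..<3}" "distinct_adj (X k q)"
        "0 < k \<longrightarrow> hd (X k q) = col (k - 1)" by auto
      \<comment> \<open>Two successive edges of one colour would make the cycle turn back, although
        it has at least three distinct vertices.\<close>
      have hd: "hd (X k q) \<noteq> col k" if "X k q \<noteq> []"
      proof
        assume "hd (X k q) = col k"
        moreover have k0: "0 < k" using that IH(1) by (cases k) auto
        ultimately have "col (k - 1) = col k" using IH(4) by simp
        then have "X (Suc k) = X (k - 1)"
          using col(2)[of k] col(2)[of "k - 1"] n_inv[OF col(1)] k0 by simp
        then have "Suc k mod m = (k - 1) mod m"
          using nth_eq_iff_index_eq[OF dist, of "Suc k mod m" "(k - 1) mod m"] m3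
            mod_less_divisor[of m "Suc k"] mod_less_divisor[of m "k - 1"]
          by (simp add: X_def m_def[symmetric])
        then show False
        proof (cases "Suc k = m")
          case True
          then show ?thesis using \<open>Suc k mod m = (k - 1) mod m\<close> m3 k0 by simp
        next
          case False
          then show ?thesis using \<open>Suc k mod m = (k - 1) mod m\<close> Suc.prems by simp
        qed
      qed
      have "X (Suc k) q = reflect r (col k) (X k q)" using col(2)[of k] by (simp add: n_def)
      also have "\<dots> = col k # X k q"
        using IH hd Suc.prems mr by (auto simp: reflect_def tree_ball_def m_def)
      finally show ?case using IH hd col(1)[of k] by (auto simp: distinct_adj_Cons')
    qed
    from this[of m] have "length (X m q) = m" by simp
    moreover have "X m = X 0" by (simp add: X_def)
    ultimately show False using q m3 by simp
  qed
  have EI: "E `` {x} = (\<lambda>i. n i x) ` {..<3}" if "x \<in> V" for x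
    using that by (auto simp: E_def)
  have "coloured_host V E n L"
  proof
    show finV: "finite V"
      by (rule finite_subset[OF _ finite_permutations[OF finite_tree_ball[of r]]])
         (auto simp: V_def reflection_group_permutes)
    show "E \<subseteq> V \<times> V" using n_in by (auto simp: E_def)
    show "sym E"
    proof (rule symI)
      fix x y assume "(x, y) \<in> E"
      then obtain i where "x \<in> V" "i < 3" "y = n i x" by (auto simp: E_def)
      then show "(y, x) \<in> E" using n_in[of x i] n_inv[of i x] by (auto simp: E_def intro!: exI[of _ i])
    qed
    show "(x, x) \<notin> E" for x by (simp add: E_def) (metis n_neq)
    show "card (E `` {x}) = 3" if "x \<in> V" for x
    proof -
      have "inj_on (\<lambda>i. n i x) {..<3}" using n_inj[OF that] by (auto simp: inj_on_def)
      then show ?thesis using EI[OF that] by (simp add: card_image)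
    qed
    show "\<exists>f. bij_betw f V V \<and> f x = y \<and> (\<forall>u\<in>V. \<forall>v\<in>V. ((f u, f v) \<in> E) = ((u, v) \<in> E))"
      if xy: "x \<in> V" "y \<in> V" for x y
    proof (intro exI conjI)
      \<comment> \<open>Generators multiply on the left, so right multiplication by
        \<open>inv x \<circ> y\<close> is an automorphism, and it takes \<open>x\<close> to
        \<open>y\<close>.\<close>
      define h where "h = inv x \<circ> y"
      define g where "g = inv y \<circ> x"
      have h: "h \<in> V" "g \<in> V"
        using xy by (auto simp: V_def h_def g_def intro!: reflection_group_comp reflection_group_inv)
      have inv: "inv z \<circ> z = id" "z \<circ> inv z = id" if "z \<in> V" for z
        using bij[OF that] by (simp_all add: bij_def surj_iff inj_iff)
      have hg: "h \<circ> g = id" "g \<circ> h = id"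
        using inv[OF xy(1)] inv[OF xy(2)] unfolding h_def g_def
        by (metis comp_assoc comp_id)+
      have undo: "(z \<circ> h) \<circ> g = z" "(z \<circ> g) \<circ> h = z" for z :: "nat list \<Rightarrow> nat list"
        by (simp_all only: comp_assoc hg comp_id)
      show "bij_betw (\<lambda>z. z \<circ> h) V V"
      proof (rule bij_betw_byWitness[where f' = "\<lambda>z. z \<circ> g"])
        show "(\<lambda>z. z \<circ> h) ` V \<subseteq> V" "(\<lambda>z. z \<circ> g) ` V \<subseteq> V"
          using h reflection_group_comp unfolding V_def by blast+
      qed (simp_all only: undo, simp_all)
      show "x \<circ> h = y" using inv(2)[OF xy(1)] by (simp add: h_def comp_assoc[symmetric])
      show "\<forall>u\<in>V. \<forall>v\<in>V. ((u \<circ> h, v \<circ> h) \<in> E) = ((u, v) \<in> E)"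
      proof (intro ballI)
        fix u v assume uv: "u \<in> V" "v \<in> V"
        have uh: "u \<circ> h \<in> V" using uv h reflection_group_comp unfolding V_def by blast
        have "v \<circ> h = n i (u \<circ> h) \<longleftrightarrow> v = n i u" for i
        proof
          assume "v \<circ> h = n i (u \<circ> h)"
          then have "v \<circ> h = n i u \<circ> h" by (simp add: n_def comp_assoc)
          then have "(v \<circ> h) \<circ> g = (n i u \<circ> h) \<circ> g" by simp
          then show "v = n i u" by (simp only: undo)
        qed (simp add: n_def comp_assoc)
        then show "((u \<circ> h, v \<circ> h) \<in> E) = ((u, v) \<in> E)"
          using uv uh by (auto simp: E_def)
      qed
    qed
    show "0 < cut E Y" if Y: "Y \<subseteq> V" "Y \<noteq> {}" "Y \<noteq> V" for Y
    proof (rule ccontr)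
      assume "\<not> 0 < cut E Y"
      moreover have "finite E" using finV \<open>E \<subseteq> V \<times> V\<close> finite_subset by blast
      ultimately have none: "E \<inter> Y \<times> (-Y) = {}" by (simp add: cut_def)
      have closed: "n i y \<in> Y" if "y \<in> Y" "i < 3" for y i
      proof -
        have "(y, n i y) \<in> E" using that Y by (auto simp: E_def)
        then show ?thesis using none that by blast
      qed
      obtain y where y: "y \<in> Y" using Y by blast
      \<comment> \<open>A set that no edge leaves is closed under left multiplication by the
        generators, hence by the whole group.\<close>
      have "x \<circ> y \<in> Y" if "x \<in> reflection_group r" for x
        using that
      proof (induction rule: reflection_group.induct)
        case (step_in x i)
        then show ?case using closed[of "x \<circ> y" i] by (simp only: n_def comp_assoc)
      qed (simp only: id_comp y)
      then have "x \<in> Y" if "x \<in> V" for x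
      proof -
        have "x \<circ> inv y \<in> reflection_group r"
          using that y Y reflection_group_comp reflection_group_inv unfolding V_def by blast
        then have "(x \<circ> inv y) \<circ> y \<in> Y" by fact
        moreover have "inv y \<circ> y = id" using bij[of y] y Y by (metis bij_def inj_iff subsetD)
        ultimately show ?thesis by (simp only: comp_assoc comp_id)
      qed
      then show False using Y by blast
    qed
    show "6 < length xs" "L < length xs" if "cycle_list E xs" for xs
      using girth[OF that] by (auto simp: r_def)
    show "V \<noteq> {}" unfolding V_def using reflection_group.id_in by blast
    show "E = {(x, n i x) | x i. x \<in> V \<and> i < 3}" by (rule E_def)
    show "n i (n i x) = x" if "x \<in> V" "i < 3" for x i using n_inv that by simp
    show "i = j" if "x \<in> V" "i < 3" "j < 3" "n i x = n j x" for x i j using n_inj that by blast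
  qed
  then show ?thesis by blast
qed

section \<open>From symmetric relations to multigraphs\<close>

text \<open>Properness is stated vertex by vertex, so that a colouring of the graph without two
  vertices can be given as one of all edges with defects only at those two.\<close>

definition proper_at :: "('a \<times> 'a) set \<Rightarrow> ('a set \<Rightarrow> nat) \<Rightarrow> 'a \<Rightarrow> bool" where
  "proper_at E c x \<longleftrightarrow> (\<forall>y. (x, y) \<in> E \<longrightarrow> c {x, y} < 3) \<and>
     (\<forall>y z. (x, y) \<in> E \<longrightarrow> (x, z) \<in> E \<longrightarrow> y \<noteq> z \<longrightarrow> c {x, y} \<noteq> c {x, z})"

text \<open>By \<open>cut3\<close> and \<open>cut4\<close> the graph is 3-edge-connected and its
  3-edge cuts are trivial. The injections \<open>f\<close> and \<open>h\<close> merely name vertices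
  and edges by numbers.\<close>

locale relation_graph = cubic_relation V E for V :: "'a set" and E +
  fixes L :: nat and f :: "'a \<Rightarrow> nat" and h :: "'a set \<Rightarrow> nat"
  assumes girth: "cycle_list E xs \<Longrightarrow> L \<le> length xs" and L5: "5 \<le> L"
    and V_big: "2 < card V"
    and cut3: "\<lbrakk>X \<subseteq> V; X \<noteq> {}; X \<noteq> V\<rbrakk> \<Longrightarrow> 3 \<le> cut E X"
    and cut4: "\<lbrakk>X \<subseteq> V; X \<noteq> {}; X \<noteq> V; cut E X = 3\<rbrakk> \<Longrightarrow> card X = 1 \<or> card (V - X) = 1"
    and f_inj: "inj_on f V"
    and h_inj: "inj_on h ((\<lambda>(x, y). {x, y}) ` E)"
begin

abbreviation pairs :: "'a set set" where
  "pairs \<equiv> (\<lambda>(x, y). {x, y}) ` E"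

definition G :: "(nat, nat) multigraph" where
  "G = \<lparr>vertices = f ` V, edges = h ` pairs, ends = (\<lambda>e. f ` inv_into pairs h e)\<rparr>"

lemma vertices_G: "vertices G = f ` V" by (simp add: G_def)

lemma E_in: "(x, y) \<in> E \<Longrightarrow> x \<in> V \<and> y \<in> V" using EV by auto

lemma pairsI: "(x, y) \<in> E \<Longrightarrow> {x, y} \<in> pairs" by force

lemma edges_G: "e \<in> edges G \<longleftrightarrow> (\<exists>x y. (x, y) \<in> E \<and> e = h {x, y})"
  by (force simp: G_def)

lemma ends_G: "(x, y) \<in> E \<Longrightarrow> ends G (h {x, y}) = {f x, f y}"
  using inv_into_f_f[OF h_inj pairsI] by (simp add: G_def)

lemma h_eq: "(x, y) \<in> E \<Longrightarrow> (x', y') \<in> E \<Longrightarrow> h {x, y} = h {x', y'} \<Longrightarrow> {x, y} = {x', y'}"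
  using h_inj pairsI by (metis inj_onD)

lemma f_eq: "x \<in> V \<Longrightarrow> y \<in> V \<Longrightarrow> f x = f y \<longleftrightarrow> x = y"
  using f_inj by (auto simp: inj_on_def)

lemma ends_f: "(x, y) \<in> E \<Longrightarrow> z \<in> V \<Longrightarrow> f z \<in> {f x, f y} \<longleftrightarrow> z = x \<or> z = y"
  using f_eq E_in by auto

lemma finite_G: "finite_multigraph G"
proof -
  have "card {f x, f y} = 2" if "(x, y) \<in> E" for x y
    using that irrE f_eq E_in by (metis card_2_iff)
  then show ?thesis
    using finV finE E_in unfolding finite_multigraph_def
    by (auto simp: vertices_G edges_G ends_G) (simp add: G_def)
qed

lemma no_loop_G: "e \<in> edges G \<Longrightarrow> ends G e \<noteq> {w}"
proof
  assume "e \<in> edges G" "ends G e = {w}"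
  then obtain x y where xy: "(x, y) \<in> E" "{f x, f y} = {w}"
    by (auto simp: edges_G ends_G)
  then have "f x = f y" by auto
  then show False using f_eq E_in[OF xy(1)] xy(1) irrE by auto
qed

lemma cubic_G: "cubic G"
  unfolding cubic_def
proof
  fix w assume "w \<in> vertices G"
  then obtain x where x: "x \<in> V" "w = f x" by (auto simp: vertices_G)
  have "{e \<in> edges G. w \<in> ends G e} = (\<lambda>y. h {x, y}) ` (E `` {x})"
  proof (rule set_eqI iffI)+
    fix e assume "e \<in> {e \<in> edges G. w \<in> ends G e}"
    then obtain a b where ab: "(a, b) \<in> E" "e = h {a, b}" "w \<in> {f a, f b}"
      by (auto simp: edges_G ends_G)
    then have "x = a \<or> x = b" using ends_f[OF ab(1) x(1)] x(2) by simp
    then show "e \<in> (\<lambda>y. h {x, y}) ` (E `` {x})"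
      using ab E_sym by (auto simp: insert_commute)
  next
    fix e assume "e \<in> (\<lambda>y. h {x, y}) ` (E `` {x})"
    then show "e \<in> {e \<in> edges G. w \<in> ends G e}"
      using x by (auto simp: edges_G ends_G)
  qed
  moreover have "inj_on (\<lambda>y. h {x, y}) (E `` {x})"
    using h_eq by (auto simp: inj_on_def doubleton_eq_iff)
  moreover have "{e \<in> edges G. ends G e = {w}} = {}" using no_loop_G by auto
  ultimately show "degree G w = 3"
    using deg3[OF x(1)] unfolding degree_def by (simp only: card_image card.empty)
qed

lemma adjacent_G: "x \<in> V \<Longrightarrow> y \<in> V \<Longrightarrow> (x, y) \<in> E \<Longrightarrow> adjacent G (f x) (f y)"
  unfolding adjacent_def by (rule bexI[of _ "h {x, y}"]) (use edges_G ends_G in blast)+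

lemma circuit_length:
  assumes "circuit G vs es"
  shows "L \<le> length es"
proof -
  define m where "m = length es"
  have c: "es \<noteq> []" "length vs = m" "distinct vs" "distinct es" "set vs \<subseteq> f ` V" "set es \<subseteq> edges G"
    and e: "\<And>i. i < m \<Longrightarrow> ends G (es ! i) = {vs ! i, vs ! (Suc i mod m)}"
    using assms by (auto simp: circuit_def vertices_G m_def)
  have m0: "0 < m" using c by (simp add: m_def)
  have edge: "es ! i \<in> edges G" if "i < m" for i using c(6) that by (auto simp: m_def)
  have "m \<noteq> 1" using e[of 0] edge[of 0] no_loop_G by auto
  moreover have "m \<noteq> 2"
  proof
    assume m2: "m = 2"
    have "ends G (es ! 0) = ends G (es ! 1)" using e[of 0] e[of 1] m2 by auto
    moreover obtain x y where xy: "(x, y) \<in> E" "es ! 0 = h {x, y}" using edge[of 0] m2 edges_G by auto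
    moreover obtain x' y' where xy': "(x', y') \<in> E" "es ! 1 = h {x', y'}" using edge[of 1] m2 edges_G by auto
    ultimately have "{f x, f y} = {f x', f y'}" by (simp add: ends_G)
    then have "{x, y} = {x', y'}" using E_in xy(1) xy'(1) f_eq by (auto simp: doubleton_eq_iff)
    then have "es ! 0 = es ! 1" using xy xy' by simp
    then show False using c(4) m2 by (simp add: m_def nth_eq_iff_index_eq)
  qed
  ultimately have m3: "3 \<le> m" using m0 by simp
  define xs where "xs = map (inv_into V f) vs"
  have lx: "length xs = m" using c by (simp add: xs_def)
  have xs: "xs ! i \<in> V" "f (xs ! i) = vs ! i" if "i < m" for i
    using c that by (auto simp: xs_def inv_into_into f_inv_into_f subset_iff)
  have XE: "(xs ! i, xs ! (Suc i mod m)) \<in> E" if i: "i < m" for i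
  proof -
    have j: "Suc i mod m < m" using m0 by simp
    obtain x y where xy: "(x, y) \<in> E" "es ! i = h {x, y}" using edge[OF i] edges_G by auto
    then have "{f x, f y} = {f (xs ! i), f (xs ! (Suc i mod m))}"
      using e[OF i] xs(2)[OF i] xs(2)[OF j] by (simp add: ends_G)
    then have "{x, y} = {xs ! i, xs ! (Suc i mod m)}"
      using xs(1)[OF i] xs(1)[OF j] E_in[OF xy(1)] f_eq by (auto simp: doubleton_eq_iff)
    then show ?thesis using xy(1) E_sym by (auto simp: doubleton_eq_iff)
  qed
  have "cycle_list E xs"
    unfolding cycle_list_def
  proof (intro conjI)
    show "3 \<le> length xs" using m3 lx by simp
    show "distinct xs" using c by (auto simp: xs_def distinct_map inj_on_inv_into)
    have "(xs ! k, xs ! Suc k) \<in> E" if "Suc k < length xs" for k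
      using XE[of k] that lx by simp
    then show "successively (\<lambda>x y. (x, y) \<in> E) xs" by (rule successively_nthI)
    have "(xs ! (m - 1), xs ! 0) \<in> E" using XE[of "m - 1"] m0 by simp
    then show "(last xs, hd xs) \<in> E"
      using lx m0 by (auto simp: last_conv_nth hd_conv_nth)
  qed
  from girth[OF this] show ?thesis using lx m_def by simp
qed

lemma girth_G: "enat L \<le> Defs.girth G"
  unfolding Defs.girth_def by (rule Inf_greatest) (auto dest: circuit_length)

lemma cut_pullback:
  assumes X: "X \<subseteq> V" and S: "finite S" "\<And>x y. \<lbrakk>(x, y) \<in> E; x \<in> X; y \<notin> X\<rbrakk> \<Longrightarrow> h {x, y} \<in> S"
  shows "cut E X \<le> card S"
  unfolding cut_def
proof (rule card_inj_on_le[where f = "\<lambda>(x, y). h {x, y}"])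
  show "inj_on (\<lambda>(x, y). h {x, y}) (E \<inter> X \<times> - X)"
    using h_eq by (auto simp: inj_on_def doubleton_eq_iff)
qed (use S in auto)

lemma joined_sym: "joined G' x y \<Longrightarrow> joined G' y x"
proof -
  assume "joined G' x y"
  then have "(adjacent G')\<^sup>*\<^sup>* x y" by (simp add: joined_def)
  moreover have "symp (adjacent G')" by (auto simp: symp_def adjacent_def insert_commute)
  ultimately show ?thesis by (metis joined_def symp_rtranclp sympD)
qed

text \<open>Suppose that deleting at most one vertex leaves parts \<open>R\<close> and
  \<open>Z\<close> without edges between them. All edges leaving the parts end in the deleted
  vertex, which has degree three, while each part has at least three such edges.\<close>

lemma connected_G: "k_connected 2 G"
  unfolding k_connected_def
proof (intro conjI allI impI)
  show "2 < card (vertices G)" using V_big f_inj by (simp add: vertices_G card_image)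
  fix X assume X: "X \<subseteq> vertices G" "card X < 2"
  have fX: "finite X" using X(1) finV finite_subset by (auto simp: vertices_G)
  define H where "H = delete_vertices G X"
  have vH: "vertices H = f ` V - X" by (auto simp: H_def delete_vertices_def induced_def vertices_G)
  have adjH: "adjacent H (f x) (f y)" if "(x, y) \<in> E" "f x \<notin> X" "f y \<notin> X" for x y
    using that E_in unfolding adjacent_def H_def delete_vertices_def induced_def
    by (auto simp: edges_G ends_G vertices_G intro!: exI[of _ "h {x, y}"])
  have "vertices H \<noteq> {}"
  proof
    assume "vertices H = {}"
    then have "card (f ` V) \<le> card X" using vH fX by (intro card_mono) auto
    then show False using X V_big f_inj by (simp add: card_image)
  qed
  moreover have "joined H a b" if ab: "a \<in> vertices H" "b \<in> vertices H" for a b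
  proof (rule ccontr)
    assume nj: "\<not> joined H a b"
    define R where "R = {x \<in> V. f x \<notin> X \<and> joined H a (f x)}"
    define Z where "Z = {x \<in> V. f x \<notin> X \<and> \<not> joined H a (f x)}"
    have R: "R \<subseteq> V" "R \<noteq> {}" and Z: "Z \<subseteq> V" "Z \<noteq> {}" and RZ: "R \<inter> Z = {}"
      using ab nj by (auto simp: R_def Z_def vH joined_def)
    have noE: "(x, y) \<notin> E" if "x \<in> R" "y \<in> Z" for x y
    proof
      assume "(x, y) \<in> E"
      then have "adjacent H (f x) (f y)" using adjH that by (auto simp: R_def Z_def)
      then show False using that unfolding R_def Z_def joined_def by (auto intro: rtranclp.rtrancl_into_rtrancl)
    qed
    have "\<exists>W. W \<subseteq> V \<and> card W \<le> 1 \<and> V = R \<union> Z \<union> W \<and> W \<inter> (R \<union> Z) = {}"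
    proof (intro exI conjI)
      let ?W = "{x \<in> V. f x \<in> X}"
      have "card ?W \<le> card X"
        by (rule card_inj_on_le[where f = f]) (use f_inj fX in \<open>auto intro: inj_on_subset\<close>)
      then show "card ?W \<le> 1" using X by simp
      show "V = R \<union> Z \<union> ?W" by (auto simp: R_def Z_def)
      show "?W \<inter> (R \<union> Z) = {}" by (auto simp: R_def Z_def)
    qed auto
    then obtain W where W: "W \<subseteq> V" "card W \<le> 1" "V = R \<union> Z \<union> W" "W \<inter> (R \<union> Z) = {}" by blast
    have fW: "finite W" using W(1) finV finite_subset by blast
    have "E \<inter> R \<times> (-R) \<union> E \<inter> Z \<times> (-Z) \<subseteq> (\<lambda>(w, x). (x, w)) ` (SIGMA w:W. E `` {w})"
    proof
      fix p assume "p \<in> E \<inter> R \<times> (-R) \<union> E \<inter> Z \<times> (-Z)"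
      then obtain x y where p: "p = (x, y)" "(x, y) \<in> E" "x \<in> R \<and> y \<notin> R \<or> x \<in> Z \<and> y \<notin> Z" by auto
      then have "y \<in> W" using E_in W noE E_sym by blast
      then show "p \<in> (\<lambda>(w, x). (x, w)) ` (SIGMA w:W. E `` {w})"
        using p E_sym by (auto simp: image_iff)
    qed
    then have "card (E \<inter> R \<times> (-R) \<union> E \<inter> Z \<times> (-Z)) \<le> card ((\<lambda>(w, x). (x, w)) ` (SIGMA w:W. E `` {w}))"
      using fW finE by (intro card_mono) (auto intro: finite_Image)
    also have "\<dots> \<le> card (SIGMA w:W. E `` {w})"
      using fW finE by (intro card_image_le) (auto intro: finite_Image)
    also have "\<dots> = (\<Sum>w\<in>W. card (E `` {w}))" using fW finE by (simp add: finite_Image)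
    also have "\<dots> = (\<Sum>w\<in>W. 3)" using deg3 W(1) by (intro sum.cong) auto
    also have "\<dots> \<le> 3" using W(2) by simp
    finally have "card (E \<inter> R \<times> (-R) \<union> E \<inter> Z \<times> (-Z)) \<le> 3" .
    moreover have "card (E \<inter> R \<times> (-R) \<union> E \<inter> Z \<times> (-Z)) = cut E R + cut E Z"
      unfolding cut_def using finE RZ by (intro card_Un_disjoint) auto
    moreover have "3 \<le> cut E R" "3 \<le> cut E Z" using cut3 R Z RZ by blast+
    ultimately show False by simp
  qed
  ultimately show "connected_graph (delete_vertices G X)"
    by (auto simp: connected_graph_def H_def)
qed

text \<open>By the girth, components with circuits have at least five vertices. So fewer than four
  deleted edges would contain a cut with at least five vertices on both sides, against
  \<open>cut3\<close> and \<open>cut4\<close>.\<close>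

lemma cyclically_connected_G: "cyclically_edge_connected 4 G"
  unfolding cyclically_edge_connected_def
proof (intro notI, elim exE conjE bexE)
  fix S C D
  assume S: "S \<subseteq> edges G" "card S < 4"
    and C: "C \<in> components (delete_edges G S)" "has_circuit C"
    and D: "D \<in> components (delete_edges G S)" "has_circuit D" and CD: "C \<noteq> D"
  let ?H = "delete_edges G S"
  have fS: "finite S" using S(1) finite_G finite_subset by (auto simp: finite_multigraph_def)
  have long: "5 \<le> length vs" if "circuit (induced ?H U) vs es" for U vs es
  proof -
    have "circuit G vs es" using that by (auto simp: circuit_def induced_def delete_edges_def)
    then show ?thesis using circuit_length[of vs es] L5 by (auto simp: circuit_def)
  qed
  have big: "5 \<le> card {x \<in> V. joined ?H a (f x)}"
    if hc: "has_circuit (induced ?H {w \<in> vertices ?H. joined ?H a w})" for a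
  proof -
    obtain vs es where c: "circuit (induced ?H {w \<in> vertices ?H. joined ?H a w}) vs es"
      using hc unfolding has_circuit_def by blast
    have "set vs \<subseteq> f ` {x \<in> V. joined ?H a (f x)}"
      using c by (auto simp: circuit_def induced_def delete_edges_def vertices_G)
    then have "card (set vs) \<le> card (f ` {x \<in> V. joined ?H a (f x)})"
      using finV by (intro card_mono) auto
    also have "\<dots> \<le> card {x \<in> V. joined ?H a (f x)}" using finV by (intro card_image_le) auto
    finally show ?thesis using long[OF c] c by (auto simp: circuit_def distinct_card)
  qed
  obtain a where a: "C = induced ?H {w \<in> vertices ?H. joined ?H a w}" using C(1) by (auto simp: components_def)
  obtain b where b: "D = induced ?H {w \<in> vertices ?H. joined ?H b w}" using D(1) by (auto simp: components_def)
  define X where "X = {x \<in> V. joined ?H a (f x)}"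
  define Y where "Y = {x \<in> V. joined ?H b (f x)}"
  have cX: "5 \<le> card X" and cY: "5 \<le> card Y" using big C(2) D(2) a b by (auto simp: X_def Y_def)
  have "X \<inter> Y = {}"
  proof (rule ccontr)
    assume "X \<inter> Y \<noteq> {}"
    then obtain x where x: "joined ?H a (f x)" "joined ?H b (f x)" by (auto simp: X_def Y_def)
    have "joined ?H a w \<longleftrightarrow> joined ?H b w" for w
      using x joined_sym unfolding joined_def by (metis rtranclp_trans)
    then show False using CD a b by simp
  qed
  then have "Y \<subseteq> V - X" by (auto simp: Y_def)
  then have cVX: "5 \<le> card (V - X)" using cY finV card_mono[of "V - X" Y] by simp
  have XV: "X \<subseteq> V" "X \<noteq> {}" "X \<noteq> V" using cX cVX by (auto simp: X_def simp del: Collect_empty_eq)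
  have "cut E X \<le> card S"
  proof (rule cut_pullback[OF XV(1) fS], rule ccontr)
    fix x y assume xy: "(x, y) \<in> E" "x \<in> X" "y \<notin> X" "h {x, y} \<notin> S"
    then have "h {x, y} \<in> edges ?H" "ends ?H (h {x, y}) = {f x, f y}"
      using edges_G ends_G by (simp_all add: delete_edges_def) blast
    then have "adjacent ?H (f x) (f y)" unfolding adjacent_def by blast
    then show False
      using xy E_in unfolding X_def joined_def by (auto intro: rtranclp.rtrancl_into_rtrancl)
  qed
  then have "cut E X = 3" using cut3[OF XV] S(2) by simp
  then show False using cut4[OF XV] cX cVX by simp
qed

lemma colourable_G:
  assumes "edge_colourable 3 G"
  shows "\<exists>c. \<forall>x\<in>V. proper_at E c x"
proof -
  obtain c :: "nat \<Rightarrow> nat" where c: "\<forall>e\<in>edges G. c e < 3"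
    "\<forall>e\<in>edges G. \<forall>e'\<in>edges G. e \<noteq> e' \<and> ends G e \<inter> ends G e' \<noteq> {} \<longrightarrow> c e \<noteq> c e'"
    using assms by (auto simp: edge_colourable_def)
  have "proper_at E (c \<circ> h) x" for x
    unfolding proper_at_def
  proof (intro conjI allI impI)
    show "(c \<circ> h) {x, y} < 3" if "(x, y) \<in> E" for y
      using c(1) that edges_G by simp blast
    show "(c \<circ> h) {x, y} \<noteq> (c \<circ> h) {x, z}" if xyz: "(x, y) \<in> E" "(x, z) \<in> E" "y \<noteq> z" for y z
    proof -
      have "h {x, y} \<noteq> h {x, z}" using h_eq[OF xyz(1,2)] xyz(3) by (auto simp: doubleton_eq_iff)
      moreover have "ends G (h {x, y}) \<inter> ends G (h {x, z}) \<noteq> {}" using xyz by (simp add: ends_G)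
      moreover have "h {x, y} \<in> edges G" "h {x, z} \<in> edges G" using xyz edges_G by blast+
      ultimately show ?thesis using c(2) by simp
    qed
  qed
  then show ?thesis by blast
qed

lemma non_removable_G:
  assumes uv: "u \<in> V" "v \<in> V" and c: "\<forall>x\<in>V - {u, v}. proper_at E c x"
  shows "non_removable G {f u, f v}"
  unfolding non_removable_def
proof
  show "{f u, f v} \<subseteq> vertices G" using uv by (simp add: vertices_G)
  let ?H = "delete_vertices G {f u, f v}"
  define c' where "c' e = c (inv_into pairs h e)" for e
  have c': "c' (h {x, y}) = c {x, y}" if "(x, y) \<in> E" for x y
    using inv_into_f_f[OF h_inj pairsI[OF that]] by (simp add: c'_def)
  have edgeH: "\<exists>x y. (x, y) \<in> E \<and> e = h {x, y} \<and> x \<notin> {u, v} \<and> y \<notin> {u, v}" if e: "e \<in> edges ?H" for e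
  proof -
    obtain x y where xy: "(x, y) \<in> E" "e = h {x, y}"
      using e by (auto simp: delete_vertices_def induced_def edges_G)
    then have "{f x, f y} \<inter> {f u, f v} = {}"
      using e by (auto simp: delete_vertices_def induced_def ends_G)
    then show ?thesis using xy by (intro exI[of _ x] exI[of _ y]) auto
  qed
  have endsH: "ends ?H = ends G" by (simp add: delete_vertices_def induced_def)
  show "edge_colourable 3 ?H"
    unfolding edge_colourable_def
  proof (intro exI conjI ballI impI)
    fix e assume "e \<in> edges ?H"
    then obtain x y where xy: "(x, y) \<in> E" "e = h {x, y}" "x \<notin> {u, v}" using edgeH by blast
    then show "c' e < 3" using c c' E_in by (auto simp: proper_at_def)
  next
    fix e e' assume ee: "e \<in> edges ?H" "e' \<in> edges ?H" "e \<noteq> e' \<and> ends ?H e \<inter> ends ?H e' \<noteq> {}"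
    obtain x y where xy: "(x, y) \<in> E" "e = h {x, y}" "x \<notin> {u, v}" "y \<notin> {u, v}" using edgeH ee by blast
    obtain x' y' where xy': "(x', y') \<in> E" "e' = h {x', y'}" "x' \<notin> {u, v}" "y' \<notin> {u, v}"
      using edgeH ee by blast
    have "{f x, f y} \<inter> {f x', f y'} \<noteq> {}" using ee xy xy' by (simp add: endsH ends_G)
    then have "x = x' \<or> x = y' \<or> y = x' \<or> y = y'"
      using f_eq E_in[OF xy(1)] E_in[OF xy'(1)] by auto
    then obtain p q r where p: "(p, q) \<in> E" "(p, r) \<in> E" "p \<notin> {u, v}" "{x, y} = {p, q}" "{x', y'} = {p, r}"
      using xy xy' E_sym[OF xy(1)] E_sym[OF xy'(1)] insert_commute[of x y "{}"] insert_commute[of x' y' "{}"]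
      by metis
    then have "q \<noteq> r" using ee xy xy' by auto
    then have "c {p, q} \<noteq> c {p, r}" using c p E_in by (auto simp: proper_at_def)
    then show "c' e \<noteq> c' e'" using c'[OF xy(1)] c'[OF xy'(1)] p xy xy' by simp
  qed
qed

lemma snark_G:
  assumes "\<not> (\<exists>c. \<forall>x\<in>V. proper_at E c x)"
  shows "nontrivial_snark G"
proof -
  have "enat 5 \<le> Defs.girth G" using girth_G L5 by (meson enat_ord_simps(1) order.trans)
  then show ?thesis
    using assms finite_G connected_G cubic_G colourable_G cyclically_connected_G
    by (auto simp: nontrivial_snark_def snark_def numeral_eq_enat)
qed

end

section \<open>Bags\<close>

lemma even_card_involution:
  assumes "finite A" "\<And>x. x \<in> A \<Longrightarrow> f x \<in> A" "\<And>x. x \<in> A \<Longrightarrow> f (f x) = x" "\<And>x. x \<in> A \<Longrightarrow> f x \<noteq> x"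
  shows "even (card A)"
  using assms
proof (induction "card A" arbitrary: A rule: less_induct)
  case less
  show ?case
  proof (cases "A = {}")
    case False
    then obtain x where x: "x \<in> A" by auto
    let ?A = "A - {x, f x}"
    have fx: "f x \<in> A" "f x \<noteq> x" "f (f x) = x" using less.prems x by auto
    have sub: "{x, f x} \<subseteq> A" using x fx by auto
    have c: "card ?A = card A - 2"
      using card_Diff_subset[OF _ sub] fx by simp
    have "2 \<le> card A" using card_mono[OF less.prems(1) sub] fx by simp
    moreover have "even (card ?A)"
    proof (rule less.hyps)
      show "card ?A < card A" using c \<open>2 \<le> card A\<close> by simp
      show "finite ?A" using less.prems by simp
      show "f y \<in> ?A" if "y \<in> ?A" for y
        using that less.prems(2,3) fx by (metis DiffD1 DiffD2 DiffI insertCI insertE singletonD)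
      show "f (f y) = y" "f y \<noteq> y" if "y \<in> ?A" for y using that less.prems by auto
    qed
    ultimately show ?thesis using c by simp
  qed simp
qed

context coloured_host
begin

definition centre :: 'a where "centre = (SOME x. x \<in> V)"

text \<open>The path \<open>n 0 centre\<close>, \<open>centre\<close>, \<open>n 1 centre\<close>;
  five edges join it to the rest.\<close>

definition removed :: "'a set" where
  "removed = {centre, n 0 centre, n 1 centre}"

definition bag :: "'a set" where "bag = V - removed"

text \<open>Port 0 is next to \<open>centre\<close>, ports 1 and 2 to \<open>n 0 centre\<close>,
  ports 3 and 4 to \<open>n 1 centre\<close>.\<close>

definition port :: "nat \<Rightarrow> 'a" where
  "port k = [n 2 centre, n 1 (n 0 centre), n 2 (n 0 centre), n 0 (n 1 centre), n 2 (n 1 centre)] ! k"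

text \<open>The host colours of the five severed edges. Colour 2 occurs at ports 0, 2 and 4, the
  other colours once; \<open>col_big\<close> prescribes the same pattern.\<close>

definition port_colour :: "nat \<Rightarrow> nat" where
  "port_colour k = [2, 1, 2, 0, 2] ! k"

definition port_end :: "nat \<Rightarrow> 'a" where
  "port_end k = n (port_colour k) (port k)"

definition bag_cut :: "'a set \<Rightarrow> nat" where
  "bag_cut Y = card (E \<inter> Y \<times> (bag - Y))"

definition ports_in :: "'a set \<Rightarrow> nat" where
  "ports_in Y = card {k \<in> {..<5}. port k \<in> Y}"

lemma centre_in: "centre \<in> V"
  using V_ne by (auto simp: centre_def some_in_eq)

lemma n_E: "x \<in> V \<Longrightarrow> i < 3 \<Longrightarrow> (x, n i x) \<in> E"
  by (auto simp: E_eq)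

lemma n_in: "x \<in> V \<Longrightarrow> i < 3 \<Longrightarrow> n i x \<in> V"
  using n_E EV by blast

lemma less3: "i < (3 :: nat) \<longleftrightarrow> i = 0 \<or> i = 1 \<or> i = 2"
  by auto

lemma less5: "i < (5 :: nat) \<longleftrightarrow> i = 0 \<or> i = 1 \<or> i = 2 \<or> i = 3 \<or> i = 4"
  by auto

lemma no_triangle: "(x, y) \<in> E \<Longrightarrow> (y, z) \<in> E \<Longrightarrow> (z, x) \<notin> E"
proof
  assume "(x, y) \<in> E" "(y, z) \<in> E" "(z, x) \<in> E"
  moreover from this have "x \<noteq> y" "y \<noteq> z" "z \<noteq> x" using irrE by auto
  ultimately have "cycle_list E [x, y, z]" by (auto simp: cycle_list_def)
  then show False using girth6 by force
qed

lemma centre_nbrs: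
  "n 0 centre \<in> V" "n 1 centre \<in> V" "n 2 centre \<in> V"
  "n 0 (n 0 centre) = centre" "n 1 (n 1 centre) = centre" "n 2 (n 2 centre) = centre"
  "n 0 centre \<noteq> n 1 centre" "n 0 centre \<noteq> n 2 centre" "n 1 centre \<noteq> n 2 centre"
  "n 0 centre \<noteq> centre" "n 1 centre \<noteq> centre" "n 2 centre \<noteq> centre"
proof -
  show "n 0 centre \<in> V" "n 1 centre \<in> V" "n 2 centre \<in> V" using n_in centre_in by simp_all
  show "n 0 (n 0 centre) = centre" "n 1 (n 1 centre) = centre" "n 2 (n 2 centre) = centre"
    using n_inv centre_in by simp_all
  show "n 0 centre \<noteq> n 1 centre" "n 0 centre \<noteq> n 2 centre" "n 1 centre \<noteq> n 2 centre"
    using n_inj[OF centre_in, of 0 1] n_inj[OF centre_in, of 0 2] n_inj[OF centre_in, of 1 2] by auto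
  have "n i centre \<noteq> centre" if "i < 3" for i
    using n_E[OF centre_in that] irrE by metis
  then show "n 0 centre \<noteq> centre" "n 1 centre \<noteq> centre" "n 2 centre \<noteq> centre" by simp_all
qed

lemma removed_in: "removed \<subseteq> V"
  using centre_in centre_nbrs by (auto simp: removed_def)

lemma card_removed: "card removed = 3"
  using centre_nbrs by (auto simp: removed_def)

lemma port_in_V: "k < 5 \<Longrightarrow> port k \<in> V"
  using centre_in n_in by (auto simp: port_def less5)

lemma port_end_eq:
  "port_end 0 = centre" "port_end (Suc 0) = n 0 centre" "port_end 2 = n 0 centre"
  "port_end 3 = n 1 centre" "port_end 4 = n 1 centre"
  using centre_in n_in n_inv by (auto simp: port_end_def port_def port_colour_def)

lemma port_colour_less: "k < 5 \<Longrightarrow> port_colour k < 3"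
  by (auto simp: port_colour_def less5)

lemma port_edge: "k < 5 \<Longrightarrow> (port k, port_end k) \<in> E"
  using n_E[OF port_in_V port_colour_less] by (simp add: port_end_def)

lemma port_end_removed: "k < 5 \<Longrightarrow> port_end k \<in> removed"
  by (auto simp: less5 port_end_eq removed_def)

lemma port_in_bag:
  assumes "k < 5"
  shows "port k \<in> bag"
proof -
  let ?c = centre
  let ?a = "n 0 centre"
  let ?b = "n 1 centre"
  have e: "(?c, ?a) \<in> E" "(?a, ?c) \<in> E" "(?c, ?b) \<in> E" "(?b, ?c) \<in> E"
    using n_E[OF centre_in] E_sym by auto
  have ea: "(?a, n i ?a) \<in> E" "(?b, n i ?b) \<in> E" if "i < 3" for i
    using n_E centre_nbrs that by auto
  have "n 2 ?c \<notin> removed" using centre_nbrs by (auto simp: removed_def)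
  moreover have "n i ?a \<notin> removed" if i: "i < 3" "i \<noteq> 0" for i
  proof -
    have "n i ?a \<noteq> ?c" using n_inj[OF centre_nbrs(1), of i 0] i centre_nbrs(4) by auto
    moreover have "n i ?a \<noteq> ?a" using ea(1)[OF i(1)] irrE by metis
    moreover have "n i ?a \<noteq> ?b" using no_triangle ea(1)[OF i(1)] e by metis
    ultimately show ?thesis by (auto simp: removed_def)
  qed
  moreover have "n i ?b \<notin> removed" if i: "i < 3" "i \<noteq> 1" for i
  proof -
    have "n i ?b \<noteq> ?c" using n_inj[OF centre_nbrs(2), of i 1] i centre_nbrs(5) by auto
    moreover have "n i ?b \<noteq> ?b" using ea(2)[OF i(1)] irrE by metis
    moreover have "n i ?b \<noteq> ?a" using no_triangle ea(2)[OF i(1)] e by metis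
    ultimately show ?thesis by (auto simp: removed_def)
  qed
  ultimately show ?thesis
    using port_in_V[OF assms] assms by (auto simp: bag_def port_def less5)
qed

text \<open>Serves to close walks inside the bag between two ports to cycles of the host.\<close>

lemma removed_path:
  assumes "r \<in> removed" "r' \<in> removed"
  shows "\<exists>rs. rs \<noteq> [] \<and> distinct rs \<and> set rs \<subseteq> removed \<and> hd rs = r \<and> last rs = r' \<and>
    successively (\<lambda>x y. (x, y) \<in> E) rs \<and> length rs \<le> 3"
proof -
  let ?c = centre
  let ?a = "n 0 centre"
  let ?b = "n 1 centre"
  have e: "(?c, ?a) \<in> E" "(?a, ?c) \<in> E" "(?c, ?b) \<in> E" "(?b, ?c) \<in> E"
    using n_E[OF centre_in] E_sym by auto
  define good where "good rs \<longleftrightarrow> rs \<noteq> [] \<and> distinct rs \<and> set rs \<subseteq> removed \<and>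
    successively (\<lambda>x y. (x, y) \<in> E) rs \<and> length rs \<le> 3" for rs
  have "good [?c]" "good [?a]" "good [?b]" "good [?c, ?a]" "good [?a, ?c]" "good [?c, ?b]" "good [?b, ?c]"
    "good [?a, ?c, ?b]" "good [?b, ?c, ?a]"
    using e centre_nbrs unfolding good_def removed_def by auto
  then have "\<exists>rs. good rs \<and> hd rs = r \<and> last rs = r'"
    using assms unfolding removed_def
    by (elim insertE emptyE) (force intro: exI[of _ "[_]"] exI[of _ "[_, _]"] exI[of _ "[_, _, _]"])+
  then show ?thesis unfolding good_def by blast
qed

text \<open>Two ports at one vertex with different ends on the removed path would give a cycle of at
  most four vertices. With a common end they belong to the same edge, hence have the same colour,
  and end and colour determine the index.\<close>

lemma port_inj: "inj_on port {..<5}"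
proof -
  have *: "port_end k = port_end l" if kl: "k < 5" "l < 5" "port k = port l" for k l
  proof (rule ccontr)
    assume ne: "port_end k \<noteq> port_end l"
    obtain rs where rs: "rs \<noteq> []" "distinct rs" "set rs \<subseteq> removed" "hd rs = port_end k"
      "last rs = port_end l" "successively (\<lambda>x y. (x, y) \<in> E) rs" "length rs \<le> 3"
      using removed_path[OF port_end_removed port_end_removed] kl by metis
    have "2 \<le> length rs" using rs ne by (cases rs; cases "tl rs") auto
    moreover have "port k \<notin> removed" using port_in_bag[OF kl(1)] by (auto simp: bag_def)
    ultimately have "cycle_list E (port k # rs)"
      using rs kl port_edge[of k] E_sym[OF port_edge[of l]] by (auto simp: cycle_list_def successively_Cons)
    then show False using girth6 rs(7) by force
  qed
  have col: "port_colour k = port_colour l" if kl: "k < 5" "l < 5" "port k = port l" for k l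
    using *[OF kl] n_inj[OF port_in_V[OF kl(1)] port_colour_less[OF kl(1)] port_colour_less[OF kl(2)]] kl(3)
    by (simp add: port_end_def)
  show ?thesis
  proof (rule inj_onI)
    fix k l assume kl: "k \<in> {..<5}" "l \<in> {..<5}" "port k = port l"
    have k5: "k < 5" "l < 5" using kl by simp_all
    note eqs = *[OF k5 kl(3)] col[OF k5 kl(3)]
    show "k = l"
      using k5[unfolded less5] eqs centre_nbrs(7,10,11) centre_nbrs(7,10,11)[symmetric]
      by (elim disjE) (simp_all add: port_end_eq port_colour_def)
  qed
qed

lemma removed_nbr:
  assumes "x \<in> bag" "r \<in> removed" "(x, r) \<in> E"
  shows "\<exists>k<5. x = port k \<and> r = port_end k"
proof -
  have "r \<in> V" using assms EV by auto
  moreover have "(r, x) \<in> E" using assms E_sym by blast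
  ultimately obtain i where i: "i < 3" "x = n i r" by (auto simp: E_eq)
  have x: "x \<notin> removed" using assms by (auto simp: bag_def)
  consider "r = centre" | "r = n 0 centre" | "r = n 1 centre" using assms(2) by (auto simp: removed_def)
  then show ?thesis
  proof cases
    case 1
    then have "i = 2" using i x by (auto simp: removed_def less3)
    then show ?thesis using i 1 by (intro exI[of _ 0]) (simp add: port_end_eq port_def)
  next
    case 2
    then have "i = 1 \<or> i = 2" using i x centre_nbrs by (auto simp: removed_def less3)
    then show ?thesis using i 2
      by (elim disjE; intro exI[of _ i]) (auto simp: port_end_eq port_def)
  next
    case 3
    then have "i = 0 \<or> i = 2" using i x centre_nbrs by (auto simp: removed_def less3)
    then show ?thesis using i 3
      by (elim disjE; intro exI[of _ "if i = 0 then 3 else 4"]) (auto simp: port_end_eq port_def)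
  qed
qed

lemma bag_in_V: "bag \<subseteq> V" by (auto simp: bag_def)

lemma finite_bag: "finite bag" using finV bag_in_V finite_subset by blast

lemma cut_to_removed:
  assumes "Y \<subseteq> bag"
  shows "card (E \<inter> Y \<times> removed) = ports_in Y"
proof -
  have "bij_betw (\<lambda>k. (port k, port_end k)) {k \<in> {..<5}. port k \<in> Y} (E \<inter> Y \<times> removed)"
    unfolding bij_betw_def
  proof
    show "inj_on (\<lambda>k. (port k, port_end k)) {k \<in> {..<5}. port k \<in> Y}"
      using port_inj by (auto simp: inj_on_def)
    show "(\<lambda>k. (port k, port_end k)) ` {k \<in> {..<5}. port k \<in> Y} = E \<inter> Y \<times> removed"
    proof (rule set_eqI iffI)+
      fix p assume "p \<in> E \<inter> Y \<times> removed"
      then obtain x r where p: "p = (x, r)" "(x, r) \<in> E" "x \<in> Y" "r \<in> removed" by auto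
      then show "p \<in> (\<lambda>k. (port k, port_end k)) ` {k \<in> {..<5}. port k \<in> Y}"
        using removed_nbr[of x r] assms by blast
    qed (auto simp: port_edge port_end_removed)
  qed
  then show ?thesis unfolding ports_in_def by (rule bij_betw_same_card[symmetric])
qed

lemma cut_bag_part:
  assumes "Y \<subseteq> bag"
  shows "cut E Y = bag_cut Y + ports_in Y"
proof -
  have "E \<inter> Y \<times> (-Y) = (E \<inter> Y \<times> (bag - Y)) \<union> (E \<inter> Y \<times> removed)"
    using assms EV by (auto simp: bag_def)
  moreover have "card ((E \<inter> Y \<times> (bag - Y)) \<union> (E \<inter> Y \<times> removed)) = bag_cut Y + ports_in Y"
    unfolding bag_cut_def cut_to_removed[OF assms, symmetric] using finE
    by (intro card_Un_disjoint) (auto simp: bag_def)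
  ultimately show ?thesis by (simp add: cut_def)
qed

lemma card_converse_Int: "card (E \<inter> X \<times> Y) = card (E \<inter> Y \<times> X)"
proof -
  have "bij_betw (\<lambda>(x, y). (y, x)) (E \<inter> X \<times> Y) (E \<inter> Y \<times> X)"
    by (rule bij_betw_byWitness[where f' = "\<lambda>(x, y). (y, x)"]) (auto simp: E_sym)
  then show ?thesis by (rule bij_betw_same_card)
qed

text \<open>A partition of the bag extends to the host in two ways. Here the removed path joins
  \<open>Y\<close>, so the severed edges at ports outside \<open>Y\<close> are cut.\<close>

lemma cut_bag_part_removed:
  assumes "Y \<subseteq> bag"
  shows "cut E (Y \<union> removed) = bag_cut Y + ports_in (bag - Y)"
proof -
  have "E \<inter> (Y \<union> removed) \<times> (- (Y \<union> removed)) = (E \<inter> Y \<times> (bag - Y)) \<union> (E \<inter> removed \<times> (bag - Y))"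
    using assms EV by (auto simp: bag_def)
  moreover have "card ((E \<inter> Y \<times> (bag - Y)) \<union> (E \<inter> removed \<times> (bag - Y))) =
      bag_cut Y + card (E \<inter> removed \<times> (bag - Y))"
    unfolding bag_cut_def using finE assms by (intro card_Un_disjoint) (auto simp: bag_def)
  ultimately show ?thesis
    using cut_to_removed[of "bag - Y"] card_converse_Int[of removed] by (simp add: cut_def)
qed

lemma ports_in_Diff:
  assumes "Y \<subseteq> bag"
  shows "ports_in Y + ports_in (bag - Y) = 5"
proof -
  have "{..<5} = {k \<in> {..<5}. port k \<in> Y} \<union> {k \<in> {..<5}. port k \<in> bag - Y}"
    using port_in_bag by auto
  then have "5 = card ({k \<in> {..<5}. port k \<in> Y} \<union> {k \<in> {..<5}. port k \<in> bag - Y})"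
    by (metis card_lessThan)
  also have "\<dots> = ports_in Y + ports_in (bag - Y)"
    unfolding ports_in_def by (intro card_Un_disjoint) auto
  finally show ?thesis by simp
qed

lemma bag_cut_Diff: "Y \<subseteq> bag \<Longrightarrow> bag_cut (bag - Y) = bag_cut Y"
  unfolding bag_cut_def using card_converse_Int[of Y "bag - Y"] by (simp add: double_diff)

text \<open>Together with the removed path, \<open>F\<close> has at most six vertices, so its cut,
  which has \<open>bag_cut F + 5 - ports_in F\<close> edges, has at least five. Hence moving
  \<open>F\<close> across a cut trades its bag cut for at most as many port edges.\<close>

lemma ports_in_small:
  assumes "F \<subseteq> bag" "card F \<le> 3"
  shows "ports_in F \<le> bag_cut F"
proof -
  have disj: "F \<inter> removed = {}" using assms by (auto simp: bag_def)
  have fF: "finite F" using assms finite_bag finite_subset by blast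
  have fr: "finite removed" using removed_in finV finite_subset by blast
  have c: "card (F \<union> removed) = card F + 3"
    using card_Un_disjoint[OF fF fr disj] card_removed by simp
  have "card (F \<union> removed) + 2 \<le> cut E (F \<union> removed)"
    using assms c bag_in_V removed_in
    by (intro cut_ge_of_no_short_cycles[of 6]) (auto simp: girth6 removed_def)
  then show ?thesis
    using cut_bag_part_removed[OF assms(1)] ports_in_Diff[OF assms(1)] c by linarith
qed

text \<open>One side has at most two ports. Putting the removed path on the other side gives a host
  cut with at most five edges, to which \<open>small_side_of_cut\<close> applies.\<close>

lemma bag_small_side:
  assumes Y: "Y \<subseteq> bag" and d: "bag_cut Y \<le> 3"
  shows "card Y \<le> 3 \<or> card (bag - Y) \<le> 3"
proof (cases "ports_in Y \<le> 2")
  case True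
  then have "cut E Y \<le> 5" using cut_bag_part[OF Y] d by simp
  then have "card Y \<le> 3 \<or> card (V - Y) \<le> 3"
    using small_side_of_cut Y bag_in_V by blast
  moreover have "card (bag - Y) \<le> card (V - Y)"
    using finV bag_in_V by (intro card_mono) auto
  ultimately show ?thesis by linarith
next
  case False
  then have "cut E (Y \<union> removed) \<le> 5"
    using cut_bag_part_removed[OF Y] ports_in_Diff[OF Y] d by simp
  then have "card (Y \<union> removed) \<le> 3 \<or> card (V - (Y \<union> removed)) \<le> 3"
    using small_side_of_cut Y bag_in_V removed_in by (meson Un_least order.trans)
  moreover have "card Y \<le> card (Y \<union> removed)"
    using finV Y bag_in_V removed_in by (intro card_mono) (auto intro: finite_subset)
  moreover have "V - (Y \<union> removed) = bag - Y" by (auto simp: bag_def)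
  ultimately show ?thesis by (metis order.trans)
qed

text \<open>The edges of colour 0 form a perfect matching of the host, and three vertices are
  removed.\<close>

lemma odd_card_bag: "odd (card bag)"
proof -
  have "even (card V)"
    using finV n_in n_inv irrE n_E
    by (intro even_card_involution[of _ "n 0"]) (auto, metis zero_less_numeral)
  moreover have "card bag = card V - 3"
    unfolding bag_def using card_removed removed_in finV
    by (subst card_Diff_subset) (auto intro: finite_subset)
  moreover have "3 \<le> card V" using card_mono[OF finV removed_in] card_removed by simp
  ultimately show ?thesis by presburger
qed

end

section \<open>Replacing the big vertices of a base graph by bags\<close>

text \<open>
  The dart \<open>(w, k)\<close> is the \<open>k\<close>-th edge end at the vertex \<open>w\<close>, and \<open>mate\<close> leads to the other end of its
  edge. A numbering in which every small vertex has at most one larger small neighbour certifies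
  that the small vertices induce a forest. The colouring is proper at the small vertices other
  than \<open>u\<close> and \<open>v\<close>; at a big vertex, one colour occurs three times, as it does on the edges between
  a path with three vertices and the rest of a 3-edge-coloured cubic graph.
\<close>

definition darts :: "nat set \<Rightarrow> nat set \<Rightarrow> (nat \<times> nat) set" where
  "darts S B = S \<times> {..<3} \<union> B \<times> {..<5}"

text \<open>In \<open>no_flow\<close> the colours stand for the three non-zero elements of the group
  of order four. The sum at a vertex vanishes iff the three colours occur with equal parity, which
  for odd degree means each an odd number of times.\<close>

locale base_graph =
  fixes S B :: "nat set" and mate :: "nat \<times> nat \<Rightarrow> nat \<times> nat"
    and u v :: nat and col :: "nat \<times> nat \<Rightarrow> nat"
  assumes finS: "finite S" and finB: "finite B" and SB: "S \<inter> B = {}"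
    and mate_in: "d \<in> darts S B \<Longrightarrow> mate d \<in> darts S B"
    and mate_mate: "d \<in> darts S B \<Longrightarrow> mate (mate d) = d"
    and mate_loop: "d \<in> darts S B \<Longrightarrow> fst (mate d) \<noteq> fst d"
    and mate_big: "d \<in> darts S B \<Longrightarrow> fst d \<in> B \<Longrightarrow> fst (mate d) \<in> S"
    and forest: "\<lbrakk>w \<in> S; k < 3; l < 3; fst (mate (w, k)) \<in> S; fst (mate (w, l)) \<in> S;
        w < fst (mate (w, k)); w < fst (mate (w, l))\<rbrakk> \<Longrightarrow> k = l"
    and linked: "\<lbrakk>X \<subseteq> S \<union> B; X \<inter> B \<noteq> {}; B - X \<noteq> {}\<rbrakk> \<Longrightarrow>
        4 \<le> card {d \<in> darts S B. fst d \<in> X \<and> fst (mate d) \<notin> X}"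
    and no_flow: "\<lbrakk>\<And>d. d \<in> darts S B \<Longrightarrow> c d < (3 :: nat) \<and> c (mate d) = c d;
        \<And>w. w \<in> S \<Longrightarrow> inj_on (\<lambda>k. c (w, k)) {..<3};
        \<And>w a. \<lbrakk>w \<in> B; a < 3\<rbrakk> \<Longrightarrow> odd (card {k \<in> {..<5}. c (w, k) = a})\<rbrakk> \<Longrightarrow> False"
    and uS: "u \<in> S" and vS: "v \<in> S" and uv: "\<exists>k<3. fst (mate (u, k)) = v"
    and col: "d \<in> darts S B \<Longrightarrow> col d < 3" "d \<in> darts S B \<Longrightarrow> col (mate d) = col d"
    and col_small: "w \<in> S - {u, v} \<Longrightarrow> inj_on (\<lambda>k. col (w, k)) {..<3}"
    and col_big: "w \<in> B \<Longrightarrow> col (w, 2) = col (w, 0)" "w \<in> B \<Longrightarrow> col (w, 4) = col (w, 0)"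
      "w \<in> B \<Longrightarrow> inj_on (\<lambda>k. col (w, k)) {0, 1, 3}"

locale blowup = base_graph S B mate u v col + coloured_host V E n L
  for S B mate u v col and V :: "'a set" and E n L
begin

abbreviation D :: "(nat \<times> nat) set" where "D \<equiv> darts S B"

text \<open>The vertex of the new graph to which a dart is attached. A small vertex stays a single
  vertex, with \<open>centre\<close> as a dummy second component.\<close>

definition loc :: "nat \<times> nat \<Rightarrow> nat \<times> 'a" where
  "loc d = (fst d, if fst d \<in> S then centre else port (snd d))"

definition GV :: "(nat \<times> 'a) set" where
  "GV = S \<times> {centre} \<union> B \<times> bag"

definition GI :: "((nat \<times> 'a) \<times> (nat \<times> 'a)) set" where
  "GI = {((w, x), (w, y)) | w x y. w \<in> B \<and> x \<in> bag \<and> y \<in> bag \<and> (x, y) \<in> E}"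

definition GX :: "((nat \<times> 'a) \<times> (nat \<times> 'a)) set" where
  "GX = (\<lambda>d. (loc d, loc (mate d))) ` D"

definition GE :: "((nat \<times> 'a) \<times> (nat \<times> 'a)) set" where
  "GE = GI \<union> GX"

lemma dart_iff: "(w, k) \<in> D \<longleftrightarrow> w \<in> S \<and> k < 3 \<or> w \<in> B \<and> k < 5"
  by (auto simp: darts_def)

lemma B_notin_S: "w \<in> B \<Longrightarrow> w \<notin> S" using SB by auto

lemma fst_loc [simp]: "fst (loc d) = fst d" by (simp add: loc_def)

lemma loc_small: "w \<in> S \<Longrightarrow> loc (w, k) = (w, centre)" by (simp add: loc_def)

lemma loc_big: "w \<in> B \<Longrightarrow> loc (w, k) = (w, port k)" using B_notin_S by (simp add: loc_def)

lemma loc_in: "d \<in> D \<Longrightarrow> loc d \<in> GV"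
  using port_in_bag by (cases d) (auto simp: dart_iff GV_def loc_def)

lemma GXI: "d \<in> D \<Longrightarrow> (loc d, loc (mate d)) \<in> GX"
  by (auto simp: GX_def)

lemma GX_fst: "(p, q) \<in> GX \<Longrightarrow> fst p \<noteq> fst q"
  using mate_loop by (auto simp: GX_def) metis

lemma GI_fst: "(p, q) \<in> GI \<Longrightarrow> fst p = fst q \<and> fst p \<in> B \<and> (snd p, snd q) \<in> E \<and> snd p \<in> bag \<and> snd q \<in> bag"
  by (auto simp: GI_def)

lemma GII: "w \<in> B \<Longrightarrow> x \<in> bag \<Longrightarrow> y \<in> bag \<Longrightarrow> (x, y) \<in> E \<Longrightarrow> ((w, x), (w, y)) \<in> GI"
  by (auto simp: GI_def)

lemma loc_inj_big:
  assumes "d \<in> D" "d' \<in> D" "fst d \<in> B" "loc d = loc d'"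
  shows "d = d'"
proof -
  obtain w k where d: "d = (w, k)" by (cases d)
  obtain w' l where d': "d' = (w', l)" by (cases d')
  have "w' = w" using assms(4) by (auto simp: d d' loc_def)
  moreover have "w \<in> B" using assms d by simp
  moreover have "k < 5" "l < 5" using assms d d' calculation B_notin_S by (auto simp: dart_iff)
  moreover have "port k = port l" using assms(4) calculation by (simp add: d d' loc_big)
  ultimately show ?thesis using port_inj d d' by (auto simp: inj_on_def)
qed

text \<open>Seen from the smaller of their ends, parallel edges would be two edges to larger small
  neighbours, which \<open>forest\<close> excludes.\<close>

lemma no_parallel:
  assumes "w \<in> S" "k < 3" "l < 3" "fst (mate (w, k)) = x" "fst (mate (w, l)) = x" "x \<in> S"
  shows "k = l"
proof (cases "w < x")
  case True
  then show ?thesis using forest assms by metis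
next
  case False
  have D: "(w, k) \<in> D" "(w, l) \<in> D" using assms by (auto simp: dart_iff)
  have "x \<noteq> w" using mate_loop[OF D(1)] assms by auto
  then have xw: "x < w" using False by simp
  obtain k' where k': "mate (w, k) = (x, k')" using assms(4) by (cases "mate (w, k)") auto
  obtain l' where l': "mate (w, l) = (x, l')" using assms(5) by (cases "mate (w, l)") auto
  have "(x, k') \<in> D" "(x, l') \<in> D" using mate_in D k' l' by metis+
  then have "k' < 3" "l' < 3" using assms(6) B_notin_S by (auto simp: dart_iff)
  moreover have "mate (x, k') = (w, k)" "mate (x, l') = (w, l)" using mate_mate D k' l' by metis+
  ultimately have "k' = l'" using forest[OF assms(6), of k' l'] assms(1) xw by simp
  then show ?thesis using \<open>mate (x, k') = (w, k)\<close> \<open>mate (x, l') = (w, l)\<close> by simp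
qed

text \<open>At a big end the port determines the dart, and two small vertices are joined by at most
  one edge. So distinct base edges remain distinct as pairs of vertices.\<close>

lemma loc_pair_inj: "inj_on (\<lambda>d. (loc d, loc (mate d))) D"
proof (rule inj_onI)
  fix d d' assume d: "d \<in> D" "d' \<in> D" and eq: "(loc d, loc (mate d)) = (loc d', loc (mate d'))"
  have md: "mate d \<in> D" "mate d' \<in> D" using d mate_in by auto
  consider "fst d \<in> B" | "fst (mate d) \<in> B" | "fst d \<in> S" "fst (mate d) \<in> S"
    using d md by (cases d; cases "mate d") (auto simp: dart_iff)
  then show "d = d'"
  proof cases
    case 1
    then show ?thesis using loc_inj_big d eq by blast
  next
    case 2
    then have "mate d = mate d'" using loc_inj_big md eq by blast
    then show ?thesis using mate_mate d by metis
  next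
    case 3
    obtain w k where wk: "d = (w, k)" by (cases d)
    have "fst d' = w" using eq wk by (metis fst_conv fst_loc prod.inject)
    then obtain l where l: "d' = (w, l)" by (cases d') auto
    have "fst (mate d') = fst (mate d)" using eq by (metis fst_loc prod.inject)
    moreover have "k < 3" "l < 3" "w \<in> S" using 3 wk l d B_notin_S by (auto simp: dart_iff)
    ultimately have "k = l" using no_parallel[of w k l] 3 wk l by simp
    then show ?thesis using wk l by simp
  qed
qed

lemma GX_small:
  assumes "(p, q) \<in> GE" "fst p \<in> S"
  shows "\<exists>k<3. q = loc (mate (fst p, k)) \<and> p = loc (fst p, k)"
proof -
  have "(p, q) \<in> GX" using assms GI_fst B_notin_S by (fastforce simp: GE_def)
  then obtain d where d: "d \<in> D" "p = loc d" "q = loc (mate d)" by (auto simp: GX_def)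
  then have "snd d < 3" using assms(2) B_notin_S by (cases d) (auto simp: dart_iff)
  then show ?thesis using d by (intro exI[of _ "snd d"]) simp
qed

lemma nbrs_small:
  assumes "w \<in> S"
  shows "GE `` {(w, centre)} = (\<lambda>k. loc (mate (w, k))) ` {..<3}"
proof (rule set_eqI iffI)+
  fix q assume "q \<in> GE `` {(w, centre)}"
  then show "q \<in> (\<lambda>k. loc (mate (w, k))) ` {..<3}" using GX_small[of "(w, centre)" q] assms by auto
next
  fix q assume "q \<in> (\<lambda>k. loc (mate (w, k))) ` {..<3}"
  then obtain k where "k < 3" "q = loc (mate (w, k))" by auto
  then show "q \<in> GE `` {(w, centre)}"
    using GXI[of "(w, k)"] assms by (auto simp: GE_def dart_iff loc_small)
qed

lemma nbrs_big:
  assumes "w \<in> B" "x \<in> bag"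
  shows "GE `` {(w, x)} = Pair w ` (E `` {x} \<inter> bag) \<union> (\<lambda>k. loc (mate (w, k))) ` {k \<in> {..<5}. port k = x}"
proof (rule set_eqI iffI)+
  fix q assume q: "q \<in> GE `` {(w, x)}"
  show "q \<in> Pair w ` (E `` {x} \<inter> bag) \<union> (\<lambda>k. loc (mate (w, k))) ` {k \<in> {..<5}. port k = x}"
  proof (cases "((w, x), q) \<in> GI")
    case True
    then show ?thesis by (auto simp: GI_def)
  next
    case False
    then obtain d where d: "d \<in> D" "(w, x) = loc d" "q = loc (mate d)" using q by (auto simp: GE_def GX_def)
    obtain k where k: "d = (w, k)" using d(2) by (cases d) (auto simp: loc_def)
    then have "k < 5" "port k = x" using d assms B_notin_S by (auto simp: dart_iff loc_big)
    then show ?thesis using d k by auto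
  qed
next
  fix q assume q: "q \<in> Pair w ` (E `` {x} \<inter> bag) \<union> (\<lambda>k. loc (mate (w, k))) ` {k \<in> {..<5}. port k = x}"
  then show "q \<in> GE `` {(w, x)}"
  proof
    assume "q \<in> Pair w ` (E `` {x} \<inter> bag)"
    then show ?thesis using assms GII by (auto simp: GE_def)
  next
    assume "q \<in> (\<lambda>k. loc (mate (w, k))) ` {k \<in> {..<5}. port k = x}"
    then obtain k where "k < 5" "port k = x" "q = loc (mate (w, k))" by auto
    then show ?thesis using GXI[of "(w, k)"] assms by (auto simp: GE_def dart_iff loc_big)
  qed
qed

sublocale G: cubic_relation GV GE
proof
  have finD: "finite D" using finS finB by (auto simp: darts_def)
  show "finite GV" using finS finB finite_bag by (auto simp: GV_def)
  show "GE \<subseteq> GV \<times> GV"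
  proof -
    have "GX \<subseteq> GV \<times> GV" unfolding GX_def using loc_in mate_in by blast
    moreover have "GI \<subseteq> GV \<times> GV" by (auto simp: GI_def GV_def)
    ultimately show ?thesis by (simp add: GE_def)
  qed
  have "(loc (mate d), loc d) \<in> GX" if "d \<in> D" for d
    using GXI[OF mate_in[OF that]] mate_mate[OF that] by simp
  then show "sym GE"
    using E_sym by (auto simp: sym_def GE_def GX_def GI_def)
  show "(p, p) \<notin> GE" for p
    using GX_fst[of p p] irrE GI_fst[of p p] by (auto simp: GE_def)
  fix p assume p: "p \<in> GV"
  show "card (GE `` {p}) = 3"
  proof (cases "fst p \<in> S")
    case True
    then have pw: "p = (fst p, centre)" using p B_notin_S by (auto simp: GV_def)
    have "inj_on (\<lambda>k. loc (mate (fst p, k))) {..<3}"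
    proof (rule inj_onI)
      fix k l assume kl: "k \<in> {..<3}" "l \<in> {..<3}" "loc (mate (fst p, k)) = loc (mate (fst p, l))"
      then have "(fst p, k) = (fst p, l)"
        using True by (intro inj_onD[OF loc_pair_inj]) (auto simp: dart_iff loc_small)
      then show "k = l" by simp
    qed
    then show ?thesis using nbrs_small[OF True] pw by (metis card_image card_lessThan)
  next
    case False
    then obtain w x where pw: "p = (w, x)" "w \<in> B" "x \<in> bag" using p by (auto simp: GV_def)
    have xV: "x \<in> V" using pw bag_in_V by auto
    have f: "finite (E `` {x})" using finE by (rule finite_Image)
    have "card (GE `` {p}) = card (Pair w ` (E `` {x} \<inter> bag)) +
        card ((\<lambda>k. loc (mate (w, k))) ` {k \<in> {..<5}. port k = x})"
      unfolding pw(1) nbrs_big[OF pw(2,3)]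
    proof (rule card_Un_disjoint)
      show "Pair w ` (E `` {x} \<inter> bag) \<inter> (\<lambda>k. loc (mate (w, k))) ` {k \<in> {..<5}. port k = x} = {}"
      proof (rule equals0I)
        fix q assume "q \<in> Pair w ` (E `` {x} \<inter> bag) \<inter> (\<lambda>k. loc (mate (w, k))) ` {k \<in> {..<5}. port k = x}"
        then obtain k y where k: "k < 5" "q = loc (mate (w, k))" "q = (w, y)" by auto
        then have "fst (mate (w, k)) = w" by (metis fst_conv fst_loc)
        then show False using k(1) mate_loop[of "(w, k)"] pw(2) by (simp add: dart_iff)
      qed
    qed (use f in auto)
    also have "card (Pair w ` (E `` {x} \<inter> bag)) = card (E `` {x} \<inter> bag)"
      by (intro card_image) (auto simp: inj_on_def)
    also have "card ((\<lambda>k. loc (mate (w, k))) ` {k \<in> {..<5}. port k = x}) = ports_in {x}"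
    proof -
      have "inj_on (\<lambda>k. loc (mate (w, k))) {k \<in> {..<5}. port k = x}"
        using port_inj by (auto simp: inj_on_def)
      then show ?thesis by (simp add: card_image ports_in_def)
    qed
    \<comment> \<open>Each neighbour lost with the removed path is replaced by one outer edge at a
      port, so the degree stays three.\<close>
    also have "ports_in {x} = card (E `` {x} \<inter> removed)"
    proof -
      have "E \<inter> {x} \<times> removed = Pair x ` (E `` {x} \<inter> removed)" by auto
      then show ?thesis using cut_to_removed[of "{x}"] pw(3) by (simp add: card_image inj_on_def)
    qed
    also have "card (E `` {x} \<inter> bag) + card (E `` {x} \<inter> removed) = card (E `` {x} \<inter> bag \<union> E `` {x} \<inter> removed)"
      using f by (intro card_Un_disjoint[symmetric]) (auto simp: bag_def)
    also have "E `` {x} \<inter> bag \<union> E `` {x} \<inter> removed = E `` {x}"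
      using EV by (auto simp: bag_def)
    also have "card (E `` {x}) = 3" by (rule deg3[OF xV])
    finally show ?thesis .
  qed
qed

text \<open>A cycle through small vertices only contradicts \<open>forest\<close>, and one inside a
  bag is a cycle of the host. Otherwise its passage through some bag has at most
  \<open>length xs - 1\<close> vertices and closes up with at most three removed vertices to a cycle
  of the host.\<close>

lemma girth_GE:
  assumes c: "cycle_list GE xs"
  shows "L < length xs + 2"
proof -
  define m where "m = length xs"
  define X where "X k = xs ! (k mod m)" for k
  have m3: "3 \<le> m" and dist: "distinct xs" using c by (auto simp: cycle_list_def m_def)
  have XE: "(X k, X (Suc k)) \<in> GE" for k using cycle_list_nth[OF c] by (simp add: X_def m_def)
  have Xeq: "X i = X j \<longleftrightarrow> i mod m = j mod m" for i j
    using nth_eq_iff_index_eq[OF dist, of "i mod m" "j mod m"] m3 mod_less_divisor[of m]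
    by (simp add: X_def m_def[symmetric])
  have Xper: "X (i + m * t) = X i" for i t by (simp add: X_def)
  have Xnear: "X (i + s) \<noteq> X (i + t)" if "s < t" "t < s + m" for i s t
  proof
    assume "X (i + s) = X (i + t)"
    then have "(i + t) mod m = (i + s) mod m" using Xeq by simp
    then have "m dvd (i + t) - (i + s)" using that by (subst (asm) mod_eq_dvd_iff_nat) auto
    then have "m dvd t - s" by simp
    then have "m \<le> t - s" using that by (intro dvd_imp_le) auto
    then show False using that by simp
  qed
  have XV: "X k \<in> GV" for k using XE G.EV by blast
  have two: "X (Suc (Suc k)) \<noteq> X k" for k using Xnear[of 0 2 k] m3 by simp
  show ?thesis
  proof (cases "\<forall>k. fst (X k) \<in> S")
    case True
    \<comment> \<open>The vertex of least number on the cycle would have two distinct larger small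
      neighbours. Its index is shifted by a full turn to give it a predecessor.\<close>
    obtain k0 where k0: "\<And>k. fst (X k0) \<le> fst (X k)"
      using ex_has_least_nat[of "\<lambda>_. True" 0 "\<lambda>k. fst (X k)"] by blast
    define j where "j = k0 + m - 1"
    have Xj: "X (Suc j) = X k0" using Xper[of k0 1] m3 by (simp add: j_def)
    define w where "w = fst (X (Suc j))"
    obtain k where k: "k < 3" "X j = loc (mate (w, k))" using GX_small[OF G.E_sym[OF XE[of j]]] True w_def by blast
    obtain l where l: "l < 3" "X (Suc (Suc j)) = loc (mate (w, l))" using GX_small[OF XE[of "Suc j"]] True w_def by blast
    have w: "w \<in> S" using True w_def by simp
    have le: "w \<le> fst (X i)" for i using k0 Xj w_def by simp
    have "w < fst (mate (w, k))" "w < fst (mate (w, l))"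
      using le[of j] le[of "Suc (Suc j)"] k l mate_loop[of "(w, k)"] mate_loop[of "(w, l)"] w
      by (auto simp: dart_iff)
    moreover have "fst (mate (w, k)) \<in> S" "fst (mate (w, l)) \<in> S"
      using True k(2) l(2) fst_loc by metis+
    ultimately have "k = l" using forest[OF w k(1) l(1)] by blast
    then show ?thesis using two[of j] k l by simp
  next
    case False
    then obtain k1 where "fst (X k1) \<notin> S" by blast
    define w where "w = fst (X k1)"
    have w: "w \<in> B" using XV[of k1] \<open>fst (X k1) \<notin> S\<close> by (auto simp: w_def GV_def)
    have int: "(snd (X k), snd (X (Suc k))) \<in> E" if "fst (X k) = w" "fst (X (Suc k)) = w" for k
      using XE[of k] GX_fst GI_fst that by (fastforce simp: GE_def)
    have inbag: "snd (X k) \<in> bag" if "fst (X k) = w" for k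
      using XV[of k] that w B_notin_S by (auto simp: GV_def)
    show ?thesis
    proof (cases "\<forall>k. fst (X k) = w")
      case True
      have "cycle_list E (map snd xs)"
        unfolding cycle_list_def
      proof (intro conjI)
        show "3 \<le> length (map snd xs)" using m3 by (simp add: m_def)
        have Xk: "xs ! k = X k" if "k < m" for k using that by (simp add: X_def)
        show "distinct (map snd xs)"
          unfolding distinct_map
        proof
          show "inj_on snd (set xs)"
          proof (rule inj_onI)
            fix p q assume pq: "p \<in> set xs" "q \<in> set xs" "snd p = snd q"
            have "fst p = w" "fst q = w"
              using pq(1,2) True Xk by (metis in_set_conv_nth m_def)+
            then show "p = q" using pq(3) by (simp add: prod_eq_iff)
          qed
        qed (rule dist)
        show "successively (\<lambda>x y. (x, y) \<in> E) (map snd xs)"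
        proof (rule successively_nthI)
          fix k assume "Suc k < length (map snd xs)"
          then show "(map snd xs ! k, map snd xs ! Suc k) \<in> E"
            using int[of k] True Xk[of k] Xk[of "Suc k"] by (simp add: m_def)
        qed
        have "X (Suc (m - 1)) = X 0" using m3 by (simp add: X_def)
        then have "(snd (xs ! (m - 1)), snd (xs ! 0)) \<in> E"
          using int[of "m - 1"] True Xk[of "m - 1"] Xk[of 0] m3 by simp
        then show "(last (map snd xs), hd (map snd xs)) \<in> E"
          using m3 m_def by (cases xs) (auto simp: last_conv_nth hd_conv_nth nth_Cons')
      qed
      from girthL[OF this] show ?thesis by simp
    next
      case False
      then obtain k2 where k2: "fst (X k2) \<noteq> w" by blast
      \<comment> \<open>From a vertex outside the bag, the first return to the bag is at index
        \<open>Suc i\<close>; from there \<open>j\<close> counts the vertices until the cycle leaves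
        it again.\<close>
      define N where "N = (LEAST j. fst (X (k2 + j)) = w)"
      have "fst (X (k2 + (k1 + (m - 1) * k2))) = w"
      proof -
        have "k2 + (k1 + (m - 1) * k2) = k1 + m * k2" using m3 by (cases m) auto
        then show ?thesis using Xper w_def by metis
      qed
      then have N: "fst (X (k2 + N)) = w" unfolding N_def by (rule LeastI)
      have "N \<noteq> 0" using N k2 by (cases N) auto
      define i where "i = k2 + N - 1"
      have Si: "Suc i = k2 + N" using \<open>N \<noteq> 0\<close> by (simp add: i_def)
      have wi: "fst (X (Suc i)) = w" using N Si by simp
      have "fst (X (k2 + (N - 1))) \<noteq> w"
        using not_less_Least[of "N - 1" "\<lambda>j. fst (X (k2 + j)) = w"] \<open>N \<noteq> 0\<close> N_def by auto
      then have ni: "fst (X i) \<noteq> w" using \<open>N \<noteq> 0\<close> by (simp add: i_def)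
      define j where "j = (LEAST j. fst (X (Suc i + j)) \<noteq> w)"
      have ex: "fst (X (Suc i + (m - 1))) \<noteq> w" using Xper[of i 1] ni m3 by simp
      then have j: "fst (X (Suc i + j)) \<noteq> w" unfolding j_def by (rule LeastI)
      have jm: "j \<le> m - 1" unfolding j_def using ex by (rule Least_le)
      have before: "fst (X (Suc i + t)) = w" if "t < j" for t
        using not_less_Least[of t] that j_def by blast
      have j0: "j \<noteq> 0" using j wi by (cases j) auto
      have "(X (Suc i), X i) \<in> GX" using G.E_sym[OF XE[of i]] ni wi GI_fst by (fastforce simp: GE_def)
      then obtain d where d: "d \<in> D" "X (Suc i) = loc d" "X i = loc (mate d)" by (auto simp: GX_def)
      have lastw: "fst (X (i + j)) = w" using before[of "j - 1"] j0 by simp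
      have "(X (i + j), X (Suc (i + j))) \<in> GX" using XE[of "i + j"] j lastw GI_fst by (fastforce simp: GE_def)
      then obtain d' where d': "d' \<in> D" "X (i + j) = loc d'" "X (Suc (i + j)) = loc (mate d')" by (auto simp: GX_def)
      obtain k where k: "d = (w, k)" "k < 5"
        using d wi w B_notin_S by (cases d) (auto simp: dart_iff)
      obtain l where l: "d' = (w, l)" "l < 5"
        using d' lastw w B_notin_S by (cases d') (auto simp: dart_iff)
      \<comment> \<open>In a passage with only one vertex, entry and exit would be the same dart,
        and the cycle would turn back.\<close>
      have j2: "2 \<le> j"
      proof (rule ccontr)
        assume "\<not> 2 \<le> j"
        then have "j = 1" using j0 by simp
        then have "d = d'" using loc_inj_big[OF d(1) d'(1)] d(2) d'(2) k w by simp
        then show False using d(3) d'(3) two[of i] \<open>j = 1\<close> by simp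
      qed
      define ys where "ys = map (\<lambda>t. snd (X (Suc i + t))) [0..<j]"
      have ly: "length ys = j" by (simp add: ys_def)
      have ys_ne: "ys \<noteq> []" using j0 by (simp add: ys_def)
      have hy: "hd ys = port k"
        using d k w j0 by (simp add: ys_def hd_map loc_big)
      have "last ys = snd (X (i + j))" using j0 by (simp add: ys_def last_map)
      then have lasty: "last ys = port l" using d' l w by (simp add: loc_big)
      have sy: "set ys \<subseteq> bag" using before inbag by (auto simp: ys_def)
      have dy: "distinct ys"
        unfolding ys_def distinct_map
      proof
        show "inj_on (\<lambda>t. snd (X (Suc i + t))) (set [0..<j])"
        proof (rule inj_onI)
          fix s t assume st: "s \<in> set [0..<j]" "t \<in> set [0..<j]" "snd (X (Suc i + s)) = snd (X (Suc i + t))"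
          then have "X (Suc i + s) = X (Suc i + t)" using before by (simp add: prod_eq_iff)
          moreover have "s < t + m" "t < s + m" using st jm m3 by auto
          ultimately show "s = t" using Xnear[of s t "Suc i"] Xnear[of t s "Suc i"]
            by (metis linorder_neqE_nat)
        qed
      qed simp
      have succ: "successively (\<lambda>x y. (x, y) \<in> E) ys"
      proof (rule successively_nthI)
        fix t assume t: "Suc t < length ys"
        then have "(snd (X (Suc i + t)), snd (X (Suc (Suc i + t)))) \<in> E"
          using before[of t] before[of "Suc t"] ly by (intro int) auto
        then show "(ys ! t, ys ! Suc t) \<in> E" using t by (simp add: ys_def)
      qed
      obtain rs where rs: "rs \<noteq> []" "distinct rs" "set rs \<subseteq> removed" "hd rs = port_end l"
        "last rs = port_end k" "successively (\<lambda>x y. (x, y) \<in> E) rs" "length rs \<le> 3"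
        using removed_path[OF port_end_removed port_end_removed, of l k] k l by blast
      have "cycle_list E (ys @ rs)"
        unfolding cycle_list_def
      proof (intro conjI)
        show "3 \<le> length (ys @ rs)" using ly j2 rs(1) by (cases rs) auto
        show "distinct (ys @ rs)" using dy rs sy by (auto simp: bag_def)
        show "successively (\<lambda>x y. (x, y) \<in> E) (ys @ rs)"
          using succ rs lasty port_edge[OF l(2)] by (simp add: successively_append_iff)
        show "(last (ys @ rs), hd (ys @ rs)) \<in> E"
          using rs hy ys_ne E_sym[OF port_edge[OF k(2)]] by simp
      qed
      from girthL[OF this] show ?thesis using ly jm rs(7) m3 by (simp add: m_def)
    qed
  qed
qed

end

section \<open>Connectivity of the blown-up graph\<close>

context blowup
begin

lemma finD: "finite D" using finS finB by (auto simp: darts_def)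

definition layer :: "(nat \<times> 'a) set \<Rightarrow> nat \<Rightarrow> 'a set" where
  "layer X w = {x \<in> bag. (w, x) \<in> X}"

lemma layer_bag: "layer X w \<subseteq> bag" by (auto simp: layer_def)

lemma cut_GE:
  assumes "X \<subseteq> GV"
  shows "cut GE X = (\<Sum>w\<in>B. bag_cut (layer X w)) + card {d \<in> D. loc d \<in> X \<and> loc (mate d) \<notin> X}"
proof -
  have GI: "GI \<inter> X \<times> (-X) = (\<Union>w\<in>B. (\<lambda>(x, y). ((w, x), (w, y))) ` (E \<inter> layer X w \<times> (bag - layer X w)))"
    by (auto simp: GI_def layer_def)
  have "card (GI \<inter> X \<times> (-X)) = (\<Sum>w\<in>B. card ((\<lambda>(x, y). ((w, x), (w, y))) ` (E \<inter> layer X w \<times> (bag - layer X w))))"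
    unfolding GI using finB finE by (intro card_UN_disjoint) auto
  also have "\<dots> = (\<Sum>w\<in>B. bag_cut (layer X w))"
    unfolding bag_cut_def by (intro sum.cong refl card_image) (auto simp: inj_on_def)
  finally have 1: "card (GI \<inter> X \<times> (-X)) = (\<Sum>w\<in>B. bag_cut (layer X w))" .
  have GX: "GX \<inter> X \<times> (-X) = (\<lambda>d. (loc d, loc (mate d))) ` {d \<in> D. loc d \<in> X \<and> loc (mate d) \<notin> X}"
    by (auto simp: GX_def)
  have 2: "card (GX \<inter> X \<times> (-X)) = card {d \<in> D. loc d \<in> X \<and> loc (mate d) \<notin> X}"
    unfolding GX by (intro card_image inj_on_subset[OF loc_pair_inj]) auto
  have "cut GE X = card ((GI \<inter> X \<times> (-X)) \<union> (GX \<inter> X \<times> (-X)))"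
    unfolding cut_def GE_def by (simp add: Int_Un_distrib2)
  also have "\<dots> = card (GI \<inter> X \<times> (-X)) + card (GX \<inter> X \<times> (-X))"
  proof (rule card_Un_disjoint)
    show "finite (GI \<inter> X \<times> (-X))" "finite (GX \<inter> X \<times> (-X))"
      using G.finE by (auto simp: GE_def)
    show "GI \<inter> X \<times> - X \<inter> (GX \<inter> X \<times> - X) = {}" using GI_fst GX_fst by fastforce
  qed
  finally show ?thesis using 1 2 by simp
qed

text \<open>
  A cut with at most three edges has a side with few vertices in each bag. Moving these
  vertices to the other side turns it into a cut of the base graph that is not larger, so it
  does not separate the big vertices.
\<close>

lemma small_cut_side:
  assumes X: "X \<subseteq> GV" and cX: "cut GE X \<le> 3"
  shows "card X \<le> card S + 3 * card B \<or> card (GV - X) \<le> card S + 3 * card B"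
proof -
  define CG where "CG = {d \<in> D. loc d \<in> X \<and> loc (mate d) \<notin> X}"
  have tot: "(\<Sum>w\<in>B. bag_cut (layer X w)) + card CG \<le> 3"
    using cut_GE[OF X] cX by (simp add: CG_def)
  have bag3: "bag_cut (layer X w) \<le> 3" if "w \<in> B" for w
  proof -
    have "bag_cut (layer X w) \<le> (\<Sum>w\<in>B. bag_cut (layer X w))"
      using that finB by (intro member_le_sum) auto
    then show ?thesis using tot by simp
  qed
  \<comment> \<open>\<open>F w\<close> holds the at most three vertices of a bag that change sides,
    \<open>X'\<close> is the resulting set of base vertices, and \<open>P\<close> holds the darts
    whose side changes.\<close>
  define F where "F w = (if card (layer X w) \<le> 3 then layer X w else bag - layer X w)" for w
  have F3: "card (F w) \<le> 3" if "w \<in> B" for w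
    using bag_small_side[OF layer_bag bag3[OF that]] by (auto simp: F_def)
  have Fbag: "F w \<subseteq> bag" for w using layer_bag by (auto simp: F_def)
  have Fcut: "bag_cut (F w) = bag_cut (layer X w)" for w
    using bag_cut_Diff[OF layer_bag] by (auto simp: F_def)
  define X' where "X' = {w \<in> S. (w, centre) \<in> X} \<union> {w \<in> B. \<not> card (layer X w) \<le> 3}"
  define P where "P = {d \<in> D. fst d \<in> B \<and> port (snd d) \<in> F (fst d)}"
  define CB where "CB = {d \<in> D. fst d \<in> X' \<and> fst (mate d) \<notin> X'}"
  have Peq: "P = (SIGMA w:B. {k \<in> {..<5}. port k \<in> F w})"
    using B_notin_S by (auto simp: P_def dart_iff)
  have "card P = (\<Sum>w\<in>B. ports_in (F w))"
    unfolding Peq ports_in_def using finB by (intro card_SigmaI) auto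
  also have "\<dots> \<le> (\<Sum>w\<in>B. bag_cut (layer X w))"
    using ports_in_small[OF Fbag F3] Fcut by (intro sum_mono) metis
  finally have cP: "card P \<le> (\<Sum>w\<in>B. bag_cut (layer X w))" .
  have key: "loc d \<in> X \<longleftrightarrow> fst d \<in> X'" if d: "d \<in> D" "d \<notin> P" for d
  proof (cases "fst d \<in> S")
    case True
    then show ?thesis using SB by (cases d) (auto simp: X'_def loc_def)
  next
    case False
    then obtain w k where wk: "d = (w, k)" "w \<in> B" "k < 5" using d(1) by (cases d) (auto simp: dart_iff)
    have "port k \<notin> F w" using d wk by (auto simp: P_def)
    moreover have "port k \<in> bag" using wk port_in_bag by simp
    ultimately show ?thesis
      using wk B_notin_S by (auto simp: F_def X'_def loc_big layer_def split: if_splits)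
  qed
  have fP: "finite P" "finite CG" "finite CB" using finD by (auto simp: P_def CG_def CB_def)
  \<comment> \<open>An edge new in the cut has an end whose side changed. Choosing this dart is
    injective, because no dart of the cut is the mate of another one.\<close>
  have "card (CB - CG) \<le> card P"
  proof (rule card_inj_on_le[where f = "\<lambda>d. if d \<in> P then d else mate d"])
    have ne: "d \<noteq> mate d'" if "d \<in> CB" "d' \<in> CB" for d d' using that by (auto simp: CB_def)
    have "mate d \<noteq> mate d'" if "d \<in> CB" "d' \<in> CB" "d \<noteq> d'" for d d'
      using that mate_mate unfolding CB_def by (metis (mono_tags, lifting) mem_Collect_eq)
    then show "inj_on (\<lambda>d. if d \<in> P then d else mate d) (CB - CG)"
      using ne by (intro inj_onI) (metis Diff_iff)
    show "(\<lambda>d. if d \<in> P then d else mate d) ` (CB - CG) \<subseteq> P"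
    proof (rule image_subsetI)
      fix d assume "d \<in> CB - CG"
      then have d: "d \<in> CB" "d \<notin> CG" by auto
      have "mate d \<in> P" if "d \<notin> P"
        using d that key[of d] key[of "mate d"] mate_in[of d] by (auto simp: CB_def CG_def)
      then show "(if d \<in> P then d else mate d) \<in> P" by simp
    qed
  qed (rule fP)
  moreover have "card CB \<le> card (CB - CG) + card CG"
    using diff_card_le_card_Diff[OF fP(2), of CB] by linarith
  ultimately have "card CB \<le> 3" using cP tot by linarith
  moreover have "X' \<subseteq> S \<union> B" by (auto simp: X'_def)
  ultimately have "X' \<inter> B = {} \<or> B - X' = {}"
    using linked[of X'] by (auto simp: CB_def)
  moreover have bound: "card Z \<le> card S + 3 * card B"
    if Z: "Z \<subseteq> GV" "\<And>w. w \<in> B \<Longrightarrow> card (layer Z w) \<le> 3" for Z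
  proof -
    have fl: "finite (layer Z w)" for w using layer_bag finite_bag finite_subset by blast
    have "Z \<subseteq> S \<times> {centre} \<union> (SIGMA w:B. layer Z w)"
      using Z(1) by (auto simp: GV_def layer_def)
    then have "card Z \<le> card (S \<times> {centre} \<union> (SIGMA w:B. layer Z w))"
      using finS finB fl by (intro card_mono) auto
    also have "\<dots> \<le> card (S \<times> {centre}) + card (SIGMA w:B. layer Z w)" by (rule card_Un_le)
    also have "\<dots> = card S + (\<Sum>w\<in>B. card (layer Z w))"
      using finB fl by (simp add: card_cartesian_product)
    also have "(\<Sum>w\<in>B. card (layer Z w)) \<le> (\<Sum>w\<in>B. 3)" by (intro sum_mono Z)
    finally show ?thesis by simp
  qed
  ultimately show ?thesis
  proof (elim disjE)
    assume "X' \<inter> B = {}"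
    then have "card (layer X w) \<le> 3" if "w \<in> B" for w using that by (auto simp: X'_def)
    then show ?thesis using bound[OF X] by blast
  next
    assume BX: "B - X' = {}"
    have "card (layer (GV - X) w) \<le> 3" if w: "w \<in> B" for w
    proof -
      have "layer (GV - X) w = bag - layer X w" using w by (auto simp: layer_def GV_def)
      moreover have "\<not> card (layer X w) \<le> 3" using BX w SB by (auto simp: X'_def)
      ultimately show ?thesis using F3[OF w] by (simp add: F_def)
    qed
    then show ?thesis using bound[of "GV - X"] by blast
  qed
qed

text \<open>Cycles are too long to fit into the small side, so it induces a forest, and its cut has
  at least two edges more than it has vertices.\<close>

lemma small_cut_trivial:
  assumes X: "X \<subseteq> GV" "X \<noteq> {}" "X \<noteq> GV" and L: "card S + 3 * card B + 2 \<le> L"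
  shows "3 \<le> cut GE X" "cut GE X = 3 \<Longrightarrow> card X = 1 \<or> card (GV - X) = 1"
proof -
  have small: "card Z + 2 \<le> cut GE Z" if "Z \<subseteq> GV" "Z \<noteq> {}" "card Z \<le> card S + 3 * card B" for Z
  proof (rule G.cut_ge_of_no_short_cycles[OF _ that])
    show "card S + 3 * card B < length xs" if "cycle_list GE xs" for xs
      using girth_GE[OF that] L by linarith
  qed
  have co: "cut GE (GV - X) = cut GE X" by (rule cut_complement[OF G.EV G.symE X(1)])
  have pos: "0 < card Z" if "Z \<subseteq> GV" "Z \<noteq> {}" for Z
    using that G.finV finite_subset by (fastforce simp: card_gt_0_iff)
  have *: "\<exists>Z\<in>{X, GV - X}. card Z + 2 \<le> cut GE X \<and> 0 < card Z" if "cut GE X \<le> 3"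
    using small_cut_side[OF X(1) that] small[of X] small[of "GV - X"] co pos[of X] pos[of "GV - X"] X by auto
  show "3 \<le> cut GE X" using * by force
  show "card X = 1 \<or> card (GV - X) = 1" if "cut GE X = 3"
    using * that by force
qed

section \<open>Colourings of the blown-up graph\<close>

lemma not_colourable:
  assumes c: "\<forall>p\<in>GV. proper_at GE c p"
  shows False
proof -
  define f where "f d = c {loc d, loc (mate d)}" for d
  have lt: "c {p, q} < 3" if "(p, q) \<in> GE" for p q
    using c[rule_format, of p] that G.EV unfolding proper_at_def by blast
  have neq: "c {p, q} \<noteq> c {p, r}" if "(p, q) \<in> GE" "(p, r) \<in> GE" "q \<noteq> r" for p q r
    using c[rule_format, of p] that G.EV unfolding proper_at_def by blast
  have dE: "(loc d, loc (mate d)) \<in> GE" if "d \<in> D" for d using GXI[OF that] by (simp add: GE_def)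
  show False
  proof (rule no_flow[of f])
    show "f d < 3 \<and> f (mate d) = f d" if "d \<in> D" for d
      using lt[OF dE[OF that]] mate_mate[OF that] by (simp add: f_def insert_commute)
    show "inj_on (\<lambda>k. f (w, k)) {..<3}" if w: "w \<in> S" for w
    proof (rule inj_onI, rule ccontr)
      fix k l assume kl: "k \<in> {..<3}" "l \<in> {..<3}" "f (w, k) = f (w, l)" "k \<noteq> l"
      have D: "(w, k) \<in> D" "(w, l) \<in> D" using kl w by (auto simp: dart_iff)
      have "loc (mate (w, k)) \<noteq> loc (mate (w, l))"
        using inj_onD[OF loc_pair_inj _ D] kl(4) w by (auto simp: loc_small)
      then have "c {(w, centre), loc (mate (w, k))} \<noteq> c {(w, centre), loc (mate (w, l))}"
        using dE[OF D(1)] dE[OF D(2)] w by (intro neq) (simp_all add: loc_small)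
      then show False using kl(3) w by (simp add: f_def loc_small)
    qed
    show "odd (card {k \<in> {..<5}. f (w, k) = a})" if w: "w \<in> B" and a: "a < 3" for w a
    proof -
      \<comment> \<open>The parity lemma for a bag: inner edges of colour \<open>a\<close> match up
        the set \<open>M\<close>, which is therefore even, and the remaining bag vertices, odd in
        number, see colour \<open>a\<close> at their ports.\<close>
      define M where "M = {x \<in> bag. \<exists>y\<in>bag. (x, y) \<in> E \<and> c {(w, x), (w, y)} = a}"
      define g where "g x = (SOME y. y \<in> bag \<and> (x, y) \<in> E \<and> c {(w, x), (w, y)} = a)" for x
      have gM: "g x \<in> bag" "(x, g x) \<in> E" "c {(w, x), (w, g x)} = a" if x: "x \<in> M" for x
      proof -
        have "\<exists>y. y \<in> bag \<and> (x, y) \<in> E \<and> c {(w, x), (w, y)} = a" using x by (auto simp: M_def)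
        then have "g x \<in> bag \<and> (x, g x) \<in> E \<and> c {(w, x), (w, g x)} = a" unfolding g_def by (rule someI_ex)
        then show "g x \<in> bag" "(x, g x) \<in> E" "c {(w, x), (w, g x)} = a" by auto
      qed
      have Mb: "x \<in> bag" if "x \<in> M" for x using that by (simp add: M_def)
      have IE: "((w, x), (w, y)) \<in> GE" if "x \<in> bag" "y \<in> bag" "(x, y) \<in> E" for x y
        using GII[OF w] that by (simp add: GE_def)
      have gin: "g x \<in> M" if "x \<in> M" for x
        using gM[OF that] Mb[OF that] E_sym by (auto simp: M_def insert_commute intro!: bexI[of _ x])
      have "even (card M)"
      proof (rule even_card_involution[of M g])
        show "finite M" using finite_bag by (simp add: M_def)
        show "g x \<in> M" if "x \<in> M" for x by (rule gin[OF that])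
        show "g x \<noteq> x" if "x \<in> M" for x using gM(2)[OF that] irrE by metis
        show "g (g x) = x" if x: "x \<in> M" for x
        proof (rule ccontr)
          assume ne: "g (g x) \<noteq> x"
          have "c {(w, g x), (w, g (g x))} \<noteq> c {(w, g x), (w, x)}"
            using gM[OF x] gM[OF gin[OF x]] Mb[OF x] E_sym ne by (intro neq IE) auto
          then show False using gM(3)[OF x] gM(3)[OF gin[OF x]] by (simp add: insert_commute)
        qed
      qed
      moreover have "bag - M = port ` {k \<in> {..<5}. f (w, k) = a}"
      proof (rule set_eqI iffI)+
        fix x assume x: "x \<in> bag - M"
        let ?h = "\<lambda>q. c {(w, x), q}"
        have "(w, x) \<in> GV" using x w by (simp add: GV_def)
        then have "card (GE `` {(w, x)}) = 3" by (rule G.deg3)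
        moreover have "inj_on ?h (GE `` {(w, x)})" by (intro inj_onI) (metis Image_singleton_iff neq)
        ultimately have "card (?h ` (GE `` {(w, x)})) = card {..<3 :: nat}" by (simp add: card_image)
        moreover have "?h ` (GE `` {(w, x)}) \<subseteq> {..<3}" using lt by auto
        ultimately have "?h ` (GE `` {(w, x)}) = {..<3}" by (intro card_subset_eq) auto
        then have "a \<in> ?h ` (GE `` {(w, x)})" using a by simp
        then obtain q where q: "((w, x), q) \<in> GE" "?h q = a" by blast
        have "q \<notin> Pair w ` (E `` {x} \<inter> bag)" using q(2) x by (auto simp: M_def)
        then obtain k where k: "k < 5" "port k = x" "q = loc (mate (w, k))"
          using q(1) nbrs_big[OF w, of x] x by auto
        then have "f (w, k) = a" using q(2) w by (simp add: f_def loc_big)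
        then show "x \<in> port ` {k \<in> {..<5}. f (w, k) = a}" using k by auto
      next
        fix x assume "x \<in> port ` {k \<in> {..<5}. f (w, k) = a}"
        then obtain k where k: "k < 5" "x = port k" "f (w, k) = a" by auto
        have kD: "(w, k) \<in> D" using k w by (simp add: dart_iff)
        have "x \<notin> M"
        proof
          assume "x \<in> M"
          then obtain y where y: "y \<in> bag" "(x, y) \<in> E" "c {(w, x), (w, y)} = a" by (auto simp: M_def)
          have "fst (mate (w, k)) \<noteq> w" using mate_loop[OF kD] by simp
          then have "(w, y) \<noteq> loc (mate (w, k))" by (metis fst_conv fst_loc)
          moreover have "((w, x), loc (mate (w, k))) \<in> GE" using dE[OF kD] k w by (simp add: loc_big)
          moreover have "((w, x), (w, y)) \<in> GE" using y k port_in_bag by (intro IE) auto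
          ultimately have "c {(w, x), (w, y)} \<noteq> c {(w, x), loc (mate (w, k))}" by (intro neq)
          then show False using y(3) k w by (simp add: f_def loc_big)
        qed
        then show "x \<in> bag - M" using k port_in_bag by simp
      qed
      moreover have "card (port ` {k \<in> {..<5}. f (w, k) = a}) = card {k \<in> {..<5}. f (w, k) = a}"
        by (intro card_image inj_on_subset[OF port_inj]) auto
      moreover have "card (bag - M) + card M = card bag"
        using finite_bag by (metis (no_types, lifting) M_def card_Diff_subset card_mono finite_subset
            le_add_diff_inverse2 mem_Collect_eq subsetI)
      ultimately show ?thesis using odd_card_bag by (metis even_add)
    qed
  qed
qed

text \<open>Host colours 0, 1, 2 become the base colours at ports 3, 1, 0, where the severed edges
  have exactly these host colours.\<close>

definition bag_colour :: "nat \<Rightarrow> nat \<Rightarrow> nat" where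
  "bag_colour w i = col (w, if i = 0 then 3 else if i = 1 then 1 else 0)"

text \<open>A relation on ordered pairs, because inner and outer edges take their colours from
  different data. Its symmetry and uniqueness make \<open>colouring\<close> well defined on
  unordered pairs.\<close>

definition hue :: "(nat \<times> 'a) \<Rightarrow> (nat \<times> 'a) \<Rightarrow> nat \<Rightarrow> bool" where
  "hue p q h \<longleftrightarrow>
     (\<exists>w x i. w \<in> B \<and> x \<in> bag \<and> n i x \<in> bag \<and> i < 3 \<and> p = (w, x) \<and> q = (w, n i x) \<and> h = bag_colour w i) \<or>
     (\<exists>d\<in>D. p = loc d \<and> q = loc (mate d) \<and> h = col d)"

definition colouring :: "(nat \<times> 'a) set \<Rightarrow> nat" where
  "colouring s = (SOME h. \<exists>p q. s = {p, q} \<and> hue p q h)"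

lemma hue_sym: "hue p q h \<Longrightarrow> hue q p h"
proof -
  assume "hue p q h"
  then consider (int) w x i where "w \<in> B" "x \<in> bag" "n i x \<in> bag" "i < 3" "p = (w, x)" "q = (w, n i x)" "h = bag_colour w i"
    | (ext) d where "d \<in> D" "p = loc d" "q = loc (mate d)" "h = col d"
    unfolding hue_def by blast
  then show "hue q p h"
  proof cases
    case int
    then have "n i (n i x) = x" using n_inv bag_in_V by auto
    then show ?thesis unfolding hue_def using int by metis
  next
    case ext
    then have "mate (mate d) = d" "col (mate d) = col d" "mate d \<in> D" using mate_mate col mate_in by auto
    then show ?thesis unfolding hue_def using ext by metis
  qed
qed

lemma hue_unique: "hue p q h \<Longrightarrow> hue p q h' \<Longrightarrow> h = h'"
proof -
  assume a: "hue p q h" "hue p q h'"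
  show "h = h'"
  proof (cases "fst p = fst q")
    case True
    have ne: "\<not> (\<exists>d\<in>D. p = loc d \<and> q = loc (mate d))" using True mate_loop by (metis fst_loc)
    obtain w x i where 1: "x \<in> bag" "i < 3" "p = (w, x)" "q = (w, n i x)" "h = bag_colour w i"
      using a(1) ne unfolding hue_def by blast
    obtain w' x' i' where 2: "i' < 3" "p = (w', x')" "q = (w', n i' x')" "h' = bag_colour w' i'"
      using a(2) ne unfolding hue_def by blast
    have "w' = w" "n i x = n i' x" using 1 2 by auto
    then show ?thesis using 1 2 n_inj[of x i i'] bag_in_V by auto
  next
    case False
    obtain d where 1: "d \<in> D" "p = loc d" "q = loc (mate d)" "h = col d"
      using a(1) False unfolding hue_def by auto
    obtain d' where 2: "d' \<in> D" "p = loc d'" "q = loc (mate d')" "h' = col d'"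
      using a(2) False unfolding hue_def by auto
    have "d = d'" using 1 2 by (intro inj_onD[OF loc_pair_inj]) auto
    then show ?thesis using 1 2 by simp
  qed
qed

lemma colouring_eq:
  assumes "hue p q h"
  shows "colouring {p, q} = h"
proof -
  have "\<exists>p' q'. {p, q} = {p', q'} \<and> hue p' q' h" using assms by blast
  then have "\<exists>p' q'. {p, q} = {p', q'} \<and> hue p' q' (colouring {p, q})"
    unfolding colouring_def by (rule someI)
  then have "hue p q (colouring {p, q})" using hue_sym by (auto simp: doubleton_eq_iff)
  then show ?thesis using hue_unique assms by blast
qed

lemma bag_colour_inj:
  assumes "w \<in> B"
  shows "inj_on (bag_colour w) {..<3}"
proof (rule inj_onI)
  fix i j assume ij: "i \<in> {..<3}" "j \<in> {..<3}" "bag_colour w i = bag_colour w j"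
  let ?k = "\<lambda>i :: nat. if i = 0 then 3 else if i = 1 then 1 else (0 :: nat)"
  have "col (w, ?k i) = col (w, ?k j)" using ij(3) by (simp only: bag_colour_def)
  then have "?k i = ?k j" by (rule inj_onD[OF col_big(3)[OF assms]]) auto
  then show "i = j"
    using ij(1,2)[unfolded lessThan_iff less3] by (elim disjE) simp_all
qed

lemma bag_colour_port:
  assumes "w \<in> B" "k < 5"
  shows "bag_colour w (port_colour k) = col (w, k)"
  using assms(2)[unfolded less5] col_big(1,2)[OF assms(1)]
  by (elim disjE) (simp_all add: bag_colour_def port_colour_def)

text \<open>The edges at a bag vertex correspond to its edges in the host, an edge to the removed
  path being replaced by the outer edge at the port. So their colours are a renaming of the host
  colours.\<close>

lemma bag_edge:
  assumes "w \<in> B" "x \<in> bag" "((w, x), q) \<in> GE"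
  shows "\<exists>i<3. colouring {(w, x), q} = bag_colour w i \<and>
    (if n i x \<in> bag then q = (w, n i x) else \<exists>k<5. port k = x \<and> port_colour k = i \<and> q = loc (mate (w, k)))"
proof -
  have "q \<in> Pair w ` (E `` {x} \<inter> bag) \<union> (\<lambda>k. loc (mate (w, k))) ` {k \<in> {..<5}. port k = x}"
    using nbrs_big[OF assms(1,2)] assms(3) by blast
  then show ?thesis
  proof
    assume "q \<in> Pair w ` (E `` {x} \<inter> bag)"
    then obtain i where i: "i < 3" "q = (w, n i x)" "n i x \<in> bag" by (auto simp: E_eq)
    then have "hue (w, x) q (bag_colour w i)" unfolding hue_def using assms by blast
    then show ?thesis using colouring_eq i by auto
  next
    assume "q \<in> (\<lambda>k. loc (mate (w, k))) ` {k \<in> {..<5}. port k = x}"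
    then obtain k where k: "k < 5" "port k = x" "q = loc (mate (w, k))" by auto
    then have "hue (w, x) q (col (w, k))"
      unfolding hue_def using assms by (intro disjI2 bexI[of _ "(w, k)"]) (auto simp: dart_iff loc_big)
    moreover have "n (port_colour k) x \<notin> bag"
      using port_end_removed[OF k(1)] k(2) by (auto simp: port_end_def bag_def)
    ultimately show ?thesis
      using colouring_eq bag_colour_port[OF assms(1) k(1)] port_colour_less[OF k(1)] k by auto
  qed
qed

text \<open>Small vertices inherit properness from \<open>col\<close>, bag vertices from the
  colouring of the host by way of \<open>bag_colour\<close>.\<close>

lemma colouring_proper:
  assumes p: "p \<in> GV - {(u, centre), (v, centre)}"
  shows "proper_at GE colouring p"
proof (cases "fst p \<in> S")
  case True
  define w where "w = fst p"
  have pw: "p = (w, centre)" "w \<in> S" "w \<in> S - {u, v}"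
    using p True B_notin_S by (auto simp: GV_def w_def)
  have col_eq: "colouring {p, loc (mate (w, k))} = col (w, k)" if "k < 3" for k
    using that pw by (intro colouring_eq) (auto simp: hue_def dart_iff loc_small intro!: bexI[of _ "(w, k)"])
  have nb: "\<exists>k<3. q = loc (mate (w, k))" if "(p, q) \<in> GE" for q
    using GX_small[OF that] True w_def by auto
  show ?thesis
    unfolding proper_at_def
  proof (intro conjI allI impI)
    fix q assume "(p, q) \<in> GE"
    then obtain k where "k < 3" "q = loc (mate (w, k))" using nb by blast
    then show "colouring {p, q} < 3" using col_eq col(1)[of "(w, k)"] pw by (simp add: dart_iff)
  next
    fix q r assume qr: "(p, q) \<in> GE" "(p, r) \<in> GE" "q \<noteq> r"
    obtain k where k: "k < 3" "q = loc (mate (w, k))" using nb qr by blast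
    obtain l where l: "l < 3" "r = loc (mate (w, l))" using nb qr by blast
    have "k \<noteq> l" using qr k l by auto
    then have "col (w, k) \<noteq> col (w, l)" using col_small[OF pw(3)] k l by (auto simp: inj_on_def)
    then show "colouring {p, q} \<noteq> colouring {p, r}" using col_eq k l by simp
  qed
next
  case False
  then obtain w x where pw: "p = (w, x)" "w \<in> B" "x \<in> bag" using p by (auto simp: GV_def)
  show ?thesis
    unfolding proper_at_def pw(1)
  proof (intro conjI allI impI)
    fix q assume "((w, x), q) \<in> GE"
    then obtain i where "colouring {(w, x), q} = bag_colour w i" using bag_edge[OF pw(2,3)] by blast
    then show "colouring {(w, x), q} < 3" using pw(2) col(1) by (auto simp: bag_colour_def dart_iff)
  next
    fix q r assume qr: "((w, x), q) \<in> GE" "((w, x), r) \<in> GE" "q \<noteq> r"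
    obtain i where i: "i < 3" "colouring {(w, x), q} = bag_colour w i"
      "if n i x \<in> bag then q = (w, n i x) else \<exists>k<5. port k = x \<and> port_colour k = i \<and> q = loc (mate (w, k))"
      using bag_edge[OF pw(2,3) qr(1)] by blast
    obtain j where j: "j < 3" "colouring {(w, x), r} = bag_colour w j"
      "if n j x \<in> bag then r = (w, n j x) else \<exists>k<5. port k = x \<and> port_colour k = j \<and> r = loc (mate (w, k))"
      using bag_edge[OF pw(2,3) qr(2)] by blast
    have "i \<noteq> j"
    proof
      assume "i = j"
      then show False using i(3) j(3) qr(3) port_inj by (auto simp: inj_on_def split: if_splits)
    qed
    then show "colouring {(w, x), q} \<noteq> colouring {(w, x), r}"
      using i j bag_colour_inj[OF pw(2)] by (auto simp: inj_on_def)
  qed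
qed

lemma uv_edge: "((u, centre), (v, centre)) \<in> GE"
proof -
  obtain k where k: "k < 3" "fst (mate (u, k)) = v" using uv by blast
  have "(loc (u, k), loc (mate (u, k))) \<in> GE" using GXI[of "(u, k)"] k uS by (simp add: GE_def dart_iff)
  moreover have "loc (mate (u, k)) = (v, centre)" using k vS by (simp add: loc_def)
  ultimately show ?thesis using uS by (simp add: loc_small)
qed

theorem large_girth_snark:
  assumes L: "card S + 3 * card B + 6 \<le> L"
  shows "\<exists>(G :: (nat, nat) multigraph) x y. nontrivial_snark G \<and> enat (L - 1) \<le> Defs.girth G \<and>
    x \<noteq> y \<and> adjacent G x y \<and> non_removable G {x, y}"
proof -
  obtain f :: "nat \<times> 'a \<Rightarrow> nat" where f: "inj_on f GV"
    using finite_imp_inj_to_nat_seg[OF G.finV] by auto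
  have fin: "finite ((\<lambda>(x, y). {x, y}) ` GE)" using G.finE by simp
  obtain h :: "(nat \<times> 'a) set \<Rightarrow> nat" where h: "inj_on h ((\<lambda>(x, y). {x, y}) ` GE)"
    using finite_imp_inj_to_nat_seg[OF fin] by auto
  have u: "(u, centre) \<in> GV" and v: "(v, centre) \<in> GV" using uS vS by (auto simp: GV_def)
  have uvne: "(u, centre) \<noteq> (v, centre)" using uv_edge G.irrE by metis
  \<comment> \<open>The bound \<open>L - 1\<close> is what \<open>L < length xs + 2\<close> leaves
    for the length of a cycle.\<close>
  interpret R: relation_graph GV GE "L - 1" f h
  proof
    show "L - 1 \<le> length xs" if "cycle_list GE xs" for xs using girth_GE[OF that] by simp
    show "5 \<le> L - 1" using L by simp
    have "card (insert (u, centre) (GE `` {(u, centre)})) \<le> card GV"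
      using u G.EV G.finV by (intro card_mono) auto
    then show "2 < card GV"
      using G.deg3[OF u] card_mono[OF G.finV, of "GE `` {(u, centre)}"] G.EV by force
    show "3 \<le> cut GE X" if "X \<subseteq> GV" "X \<noteq> {}" "X \<noteq> GV" for X
      using small_cut_trivial(1)[OF that] L by simp
    show "card X = 1 \<or> card (GV - X) = 1" if "X \<subseteq> GV" "X \<noteq> {}" "X \<noteq> GV" "cut GE X = 3" for X
      using small_cut_trivial(2)[OF that(1-3)] that(4) L by simp
  qed (rule f h)+
  have "nontrivial_snark R.G" using not_colourable by (intro R.snark_G) blast
  moreover have "enat (L - 1) \<le> Defs.girth R.G" by (rule R.girth_G)
  moreover have "f (u, centre) \<noteq> f (v, centre)" using R.f_eq[OF u v] uvne by simp
  moreover have "adjacent R.G (f (u, centre)) (f (v, centre))" by (rule R.adjacent_G[OF u v uv_edge])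
  moreover have "non_removable R.G {f (u, centre), f (v, centre)}"
    using colouring_proper by (intro R.non_removable_G[OF u v, of colouring]) blast
  ultimately show ?thesis by blast
qed

end

section \<open>The base graph\<close>

text \<open>
  \<open>incidence ! w\<close> lists the edges at the vertex \<open>w\<close>: the trees \<open>6 i, \<dots>, 6 i + 5\<close> for \<open>i < 3\<close> and
  \<open>18 + 7 j, \<dots>, 24 + 7 j\<close> for \<open>j < 4\<close> come first, followed by the vertices of degree five. The
  vertices of a tree are numbered by successively removing leaves.
\<close>

definition incidence :: "nat list list" where
  "incidence =
     [[0, 1, 2], [3, 4, 5], [6, 7, 8], [9, 10, 11], [0, 6, 12], [3, 9, 12], [13, 14, 15], [16,
     17, 18], [19, 20, 21], [22, 23, 24], [13, 19, 25], [16, 22, 25], [26, 27, 28], [29, 30,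
     31], [32, 33, 34], [35, 36, 37], [26, 32, 38], [29, 35, 38], [39, 40, 41], [42, 43, 44],
     [42, 45, 46], [47, 48, 49], [39, 50, 51], [47, 52, 53], [45, 50, 52], [54, 55, 56], [57,
     58, 59], [57, 60, 61], [62, 63, 64], [54, 65, 66], [62, 67, 68], [60, 65, 67], [69, 70,
     71], [72, 73, 74], [72, 75, 76], [77, 78, 79], [69, 80, 81], [77, 82, 83], [75, 80, 82],
     [84, 85, 86], [87, 88, 89], [87, 90, 91], [92, 93, 94], [84, 95, 96], [92, 97, 98], [90,
     95, 97], [4, 7, 43, 48, 51], [1, 10, 58, 63, 66], [5, 2, 73, 78, 81], [11, 8, 88, 93, 96],
     [17, 20, 46, 40, 49], [14, 23, 41, 44, 53], [15, 18, 55, 64, 61], [21, 24, 56, 59, 68],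
     [70, 30, 76, 33, 79], [27, 36, 74, 71, 83], [28, 85, 31, 91, 94], [37, 34, 86, 89, 98]]"

text \<open>Entry \<open>e\<close> holds the two darts of the edge \<open>e\<close>, the one at the
  smaller vertex first; this table inverts \<open>incidence\<close>.\<close>

definition edge_darts :: "((nat \<times> nat) \<times> (nat \<times> nat)) list" where
  "edge_darts =
     [((0, 0), (4, 0)), ((0, 1), (47, 0)), ((0, 2), (48, 1)), ((1, 0), (5, 0)), ((1, 1), (46,
     0)), ((1, 2), (48, 0)), ((2, 0), (4, 1)), ((2, 1), (46, 1)), ((2, 2), (49, 1)), ((3, 0),
     (5, 1)), ((3, 1), (47, 1)), ((3, 2), (49, 0)), ((4, 2), (5, 2)), ((6, 0), (10, 0)), ((6,
     1), (51, 0)), ((6, 2), (52, 0)), ((7, 0), (11, 0)), ((7, 1), (50, 0)), ((7, 2), (52, 1)),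
     ((8, 0), (10, 1)), ((8, 1), (50, 1)), ((8, 2), (53, 0)), ((9, 0), (11, 1)), ((9, 1), (51,
     1)), ((9, 2), (53, 1)), ((10, 2), (11, 2)), ((12, 0), (16, 0)), ((12, 1), (55, 0)), ((12,
     2), (56, 0)), ((13, 0), (17, 0)), ((13, 1), (54, 1)), ((13, 2), (56, 2)), ((14, 0), (16,
     1)), ((14, 1), (54, 3)), ((14, 2), (57, 1)), ((15, 0), (17, 1)), ((15, 1), (55, 1)), ((15,
     2), (57, 0)), ((16, 2), (17, 2)), ((18, 0), (22, 0)), ((18, 1), (50, 3)), ((18, 2), (51,
     2)), ((19, 0), (20, 0)), ((19, 1), (46, 2)), ((19, 2), (51, 3)), ((20, 1), (24, 0)), ((20,
     2), (50, 2)), ((21, 0), (23, 0)), ((21, 1), (46, 3)), ((21, 2), (50, 4)), ((22, 1), (24,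
     1)), ((22, 2), (46, 4)), ((23, 1), (24, 2)), ((23, 2), (51, 4)), ((25, 0), (29, 0)), ((25,
     1), (52, 2)), ((25, 2), (53, 2)), ((26, 0), (27, 0)), ((26, 1), (47, 2)), ((26, 2), (53,
     3)), ((27, 1), (31, 0)), ((27, 2), (52, 4)), ((28, 0), (30, 0)), ((28, 1), (47, 3)), ((28,
     2), (52, 3)), ((29, 1), (31, 1)), ((29, 2), (47, 4)), ((30, 1), (31, 2)), ((30, 2), (53,
     4)), ((32, 0), (36, 0)), ((32, 1), (54, 0)), ((32, 2), (55, 3)), ((33, 0), (34, 0)), ((33,
     1), (48, 2)), ((33, 2), (55, 2)), ((34, 1), (38, 0)), ((34, 2), (54, 2)), ((35, 0), (37,
     0)), ((35, 1), (48, 3)), ((35, 2), (54, 4)), ((36, 1), (38, 1)), ((36, 2), (48, 4)), ((37,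
     1), (38, 2)), ((37, 2), (55, 4)), ((39, 0), (43, 0)), ((39, 1), (56, 1)), ((39, 2), (57,
     2)), ((40, 0), (41, 0)), ((40, 1), (49, 2)), ((40, 2), (57, 3)), ((41, 1), (45, 0)), ((41,
     2), (56, 3)), ((42, 0), (44, 0)), ((42, 1), (49, 3)), ((42, 2), (56, 4)), ((43, 1), (45,
     1)), ((43, 2), (49, 4)), ((44, 1), (45, 2)), ((44, 2), (57, 4))]"

text \<open>Defective only at the vertices 4 and 5, where the colours are 1, 1, 0 and 0, 0, 0: edges
  at these vertices are constrained only at ends other than 4 and 5.\<close>

definition edge_colours :: "nat list" where
  "edge_colours =
     [1, 2, 0, 0, 1, 2, 1, 2, 0, 0, 1, 2, 0, 2, 0, 1, 1, 2, 0, 1, 0, 2, 2, 1, 0, 0, 2, 1, 0, 2,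
     1, 0, 1, 0, 2, 1, 2, 0, 0, 2, 1, 0, 0, 1, 2, 1, 2, 1, 0, 2, 0, 1, 2, 0, 0, 1, 2, 0, 2, 1,
     2, 1, 1, 0, 2, 1, 2, 0, 2, 1, 2, 0, 0, 2, 1, 1, 2, 0, 1, 2, 0, 2, 2, 1, 1, 2, 0, 0, 2, 1,
     2, 1, 2, 1, 0, 0, 2, 1, 0]"

text \<open>\<open>links\<close> gives four edge-disjoint paths for each edge of a spanning tree on the big vertices.\<close>

definition links :: "(nat \<times> nat \<times> (nat \<times> nat) list list) list" where
  "links =
     [(46, 50, [[(46, 1), (2, 2), (49, 0), (3, 1), (47, 3), (28, 2), (52, 1), (7, 1)], [(46, 2),
     (19, 0), (20, 2)], [(46, 3), (21, 2)], [(46, 4), (22, 0), (18, 1)]]), (50, 51, [[(50, 1),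
     (8, 2), (53, 1), (9, 1)], [(50, 2), (20, 0), (19, 2)], [(50, 3), (18, 2)], [(50, 4), (21,
     0), (23, 2)]]), (50, 52, [[(50, 0), (7, 2)], [(50, 1), (8, 2), (53, 2), (25, 1)], [(50, 2),
     (20, 0), (19, 2), (51, 0), (6, 2)], [(50, 3), (18, 2), (51, 1), (9, 2), (53, 3), (26, 0),
     (27, 2)]]), (52, 53, [[(52, 0), (6, 0), (10, 1), (8, 2)], [(52, 2), (25, 2)], [(52, 3),
     (28, 0), (30, 2)], [(52, 4), (27, 0), (26, 2)]]), (52, 47, [[(52, 0), (6, 1), (51, 3), (19,
     1), (46, 1), (2, 2), (49, 0), (3, 1)], [(52, 2), (25, 0), (29, 2)], [(52, 3), (28, 1)],
     [(52, 4), (27, 0), (26, 1)]]), (46, 48, [[(46, 0), (1, 2)], [(46, 1), (2, 2), (49, 2), (40,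
     2), (57, 1), (14, 1), (54, 4), (35, 1)], [(46, 2), (19, 2), (51, 0), (6, 2), (52, 3), (28,
     1), (47, 0), (0, 2)], [(46, 3), (21, 2), (50, 1), (8, 2), (53, 3), (26, 1), (47, 1), (3,
     2), (49, 3), (42, 2), (56, 0), (12, 1), (55, 2), (33, 1)]]), (48, 54, [[(48, 1), (0, 0),
     (4, 1), (2, 2), (49, 3), (42, 2), (56, 2), (13, 1)], [(48, 2), (33, 0), (34, 2)], [(48, 3),
     (35, 2)], [(48, 4), (36, 0), (32, 1)]]), (54, 55, [[(54, 0), (32, 2)], [(54, 2), (34, 0),
     (33, 2)], [(54, 3), (14, 2), (57, 0), (15, 1)], [(54, 4), (35, 0), (37, 2)]]), (54, 56,
     [[(54, 0), (32, 2), (55, 0), (12, 2)], [(54, 1), (13, 2)], [(54, 2), (34, 0), (33, 2), (55,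
     1), (15, 2), (57, 2), (39, 1)], [(54, 3), (14, 2), (57, 3), (40, 0), (41, 2)]]), (56, 57,
     [[(56, 0), (12, 0), (16, 1), (14, 2)], [(56, 1), (39, 2)], [(56, 3), (41, 0), (40, 2)],
     [(56, 4), (42, 0), (44, 2)]]), (56, 49, [[(56, 0), (12, 1), (55, 2), (33, 1), (48, 1), (0,
     0), (4, 1), (2, 2)], [(56, 1), (39, 0), (43, 2)], [(56, 3), (41, 0), (40, 1)], [(56, 4),
     (42, 1)]])]"

definition edge_of :: "nat \<times> nat \<Rightarrow> nat" where
  "edge_of d = incidence ! fst d ! snd d"

definition base_mate :: "nat \<times> nat \<Rightarrow> nat \<times> nat" where
  "base_mate d = (case edge_darts ! edge_of d of (d1, d2) \<Rightarrow> if d = d1 then d2 else d1)"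

definition base_colour :: "nat \<times> nat \<Rightarrow> nat" where
  "base_colour d = edge_colours ! edge_of d"

abbreviation base_darts :: "(nat \<times> nat) set" where
  "base_darts \<equiv> darts {..<46} {46..<58}"

lemma upt_base:
  "[0..<3] = [0, 1, 2]" "[0..<5] = [0, 1, 2, 3, 4]"
  "[0..<46] = [0, 1, 2, 3, 4, 5, 6, 7, 8, 9, 10, 11, 12, 13, 14, 15, 16, 17, 18, 19, 20, 21, 22, 23, 24,
     25, 26, 27, 28, 29, 30, 31, 32, 33, 34, 35, 36, 37, 38, 39, 40, 41, 42, 43, 44, 45]"
  "[46..<58] = [46, 47, 48, 49, 50, 51, 52, 53, 54, 55, 56, 57]"
  "[0..<99] = [0, 1, 2, 3, 4, 5, 6, 7, 8, 9, 10, 11, 12, 13, 14, 15, 16, 17, 18, 19, 20, 21, 22, 23, 24,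
     25, 26, 27, 28, 29, 30, 31, 32, 33, 34, 35, 36, 37, 38, 39, 40, 41, 42, 43, 44, 45, 46, 47,
     48, 49, 50, 51, 52, 53, 54, 55, 56, 57, 58, 59, 60, 61, 62, 63, 64, 65, 66, 67, 68, 69, 70,
     71, 72, 73, 74, 75, 76, 77, 78, 79, 80, 81, 82, 83, 84, 85, 86, 87, 88, 89, 90, 91, 92, 93,
     94, 95, 96, 97, 98]"
  by (simp_all add: upt_rec)

lemma list_all_upt: "list_all P [a..<b] \<longleftrightarrow> (\<forall>w. a \<le> w \<and> w < b \<longrightarrow> P w)"
  by (auto simp: list_all_iff)

lemma base_dart_edge:
  assumes "d \<in> base_darts"
  shows "edge_of d < 99" "d = fst (edge_darts ! edge_of d) \<or> d = snd (edge_darts ! edge_of d)"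
proof -
  let ?ok = "\<lambda>w k. edge_of (w, k) < 99 \<and>
    ((w, k) = fst (edge_darts ! edge_of (w, k)) \<or> (w, k) = snd (edge_darts ! edge_of (w, k)))"
  have 1: "list_all (\<lambda>w. list_all (\<lambda>k. ?ok w k) [0..<3]) [0..<46]"
    by (simp add: upt_base incidence_def edge_darts_def edge_of_def)
  have 2: "list_all (\<lambda>w. list_all (\<lambda>k. ?ok w k) [0..<5]) [46..<58]"
    by (simp add: upt_base incidence_def edge_darts_def edge_of_def)
  have "?ok (fst d) (snd d)"
  proof (cases "fst d < 46")
    case True
    then have "snd d < 3" using assms by (auto simp: darts_def)
    then show ?thesis using 1[unfolded list_all_upt] True by blast
  next
    case False
    then have "46 \<le> fst d \<and> fst d < 58" "0 \<le> snd d \<and> snd d < 5" using assms by (auto simp: darts_def)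
    then show ?thesis using 2[unfolded list_all_upt] by blast
  qed
  then show "edge_of d < 99" "d = fst (edge_darts ! edge_of d) \<or> d = snd (edge_darts ! edge_of d)"
    by simp_all
qed

lemma base_edge:
  assumes "e < 99" "edge_darts ! e = (d1, d2)"
  shows "fst d1 < 46" "d1 \<in> base_darts" "d2 \<in> base_darts" "fst d1 < fst d2" "edge_of d1 = e" "edge_of d2 = e"
proof -
  have all: "list_all (\<lambda>e. case edge_darts ! e of (d1, d2) \<Rightarrow>
      fst d1 < 46 \<and> snd d1 < 3 \<and> fst d2 < 58 \<and> snd d2 < (if fst d2 < 46 then 3 else 5) \<and>
      fst d1 < fst d2 \<and> edge_of d1 = e \<and> edge_of d2 = e) [0..<99]"
    by (simp add: upt_base incidence_def edge_darts_def edge_of_def)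
  have *: "fst d1 < 46 \<and> snd d1 < 3 \<and> fst d2 < 58 \<and> snd d2 < (if fst d2 < 46 then 3 else 5) \<and>
      fst d1 < fst d2 \<and> edge_of d1 = e \<and> edge_of d2 = e"
    using all[unfolded list_all_upt, rule_format, of e] assms by simp
  then show "fst d1 < 46" "fst d1 < fst d2" "edge_of d1 = e" "edge_of d2 = e" by auto
  show "d1 \<in> base_darts" "d2 \<in> base_darts"
    using * by (cases d1; cases d2; auto simp: darts_def split: if_splits)+
qed

lemma base_mate_cases:
  assumes "d \<in> base_darts"
  obtains d1 d2 where "d1 \<in> base_darts" "d2 \<in> base_darts" "fst d1 < 46" "fst d1 < fst d2"
    "edge_of d1 = edge_of d" "edge_of d2 = edge_of d" "base_mate d1 = d2" "base_mate d2 = d1"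
    "d = d1 \<or> d = d2"
proof -
  obtain d1 d2 where e: "edge_darts ! edge_of d = (d1, d2)" by (metis surj_pair)
  note b = base_edge[OF base_dart_edge(1)[OF assms] e]
  have "base_mate d1 = d2" "base_mate d2 = d1"
    using b e by (auto simp: base_mate_def)
  then show ?thesis using b base_dart_edge(2)[OF assms] e that by auto
qed

lemma base_forest:
  assumes "w < 46" "k < 3" "l < 3" "w < fst (base_mate (w, k))" "fst (base_mate (w, k)) < 46"
    "w < fst (base_mate (w, l))" "fst (base_mate (w, l)) < 46"
  shows "k = l"
proof -
  have all: "list_all (\<lambda>w. length (filter (\<lambda>k. w < fst (base_mate (w, k)) \<and> fst (base_mate (w, k)) < 46) [0..<3]) \<le> 1) [0..<46]"
    by (simp add: upt_base incidence_def edge_darts_def edge_of_def base_mate_def)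
  let ?P = "\<lambda>k. w < fst (base_mate (w, k)) \<and> fst (base_mate (w, k)) < 46"
  have "length (filter ?P [0..<3]) \<le> 1"
    using all[unfolded list_all_upt, rule_format, of w] assms(1) by blast
  moreover have "length (filter ?P [0..<3]) = card ({k. ?P k} \<inter> set [0..<3])"
    by (rule distinct_length_filter) simp
  ultimately have "card ({k. ?P k} \<inter> set [0..<3]) \<le> Suc 0" by simp
  then have "\<forall>k\<in>{k. ?P k} \<inter> set [0..<3]. \<forall>l\<in>{k. ?P k} \<inter> set [0..<3]. k = l"
    by (subst (asm) card_le_Suc0_iff_eq) auto
  moreover have "k \<in> {k. ?P k} \<inter> set [0..<3]" "l \<in> {k. ?P k} \<inter> set [0..<3]"
    using assms by (simp_all only: set_upt) auto
  ultimately show ?thesis by blast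
qed

section \<open>Edge-disjoint paths between big vertices\<close>

fun dart_path :: "nat \<Rightarrow> nat \<Rightarrow> (nat \<times> nat) list \<Rightarrow> bool" where
  "dart_path s t [] \<longleftrightarrow> s = t"
| "dart_path s t (d # ds) \<longleftrightarrow> fst d = s \<and> s < 58 \<and> snd d < (if s < 46 then 3 else 5) \<and>
     dart_path (fst (base_mate d)) t ds"

lemma dart_path_crosses:
  assumes "dart_path s t ds" "s \<in> X" "t \<notin> X"
  shows "\<exists>d\<in>set ds. d \<in> base_darts \<and> fst d \<in> X \<and> fst (base_mate d) \<notin> X"
  using assms
proof (induction ds arbitrary: s)
  case (Cons d ds)
  have "d \<in> base_darts" using Cons.prems(1) by (cases d) (auto simp: darts_def split: if_splits)
  then show ?case using Cons by (cases "fst (base_mate d) \<in> X") auto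
qed simp

lemma card_disjoint_lists:
  assumes "distinct (concat ps)" "\<And>p. p \<in> set ps \<Longrightarrow> \<exists>d\<in>set p. Q d"
  shows "length ps \<le> card {d \<in> set (concat ps). Q d}"
  using assms
proof (induction ps)
  case (Cons p ps)
  obtain d where d: "d \<in> set p" "Q d" using Cons.prems(2) by auto
  then have "d \<notin> set (concat ps)" using Cons.prems(1) by auto
  then have "Suc (card {d \<in> set (concat ps). Q d}) = card (insert d {d \<in> set (concat ps). Q d})"
    by simp
  also have "\<dots> \<le> card {d \<in> set (concat (p # ps)). Q d}"
    using d by (intro card_mono) auto
  finally show ?case using Cons by simp
qed simp

text \<open>The four paths have no dart in common, and each of them leaves \<open>X\<close> at least
  once.\<close>

lemma links_cross:
  assumes "(s, t, ps) \<in> set links" "s \<in> X" "t \<notin> X"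
  shows "4 \<le> card {d \<in> base_darts. fst d \<in> X \<and> fst (base_mate d) \<notin> X}"
proof -
  have "list_all (\<lambda>(s, t, ps). length ps = 4 \<and> list_all (dart_path s t) ps \<and> distinct (concat ps)) links"
    by (simp add: links_def incidence_def edge_darts_def edge_of_def base_mate_def)
  then have ps: "length ps = 4" "list_all (dart_path s t) ps" "distinct (concat ps)"
    using assms(1) by (auto simp: list_all_iff)
  have "length ps \<le> card {d \<in> set (concat ps). d \<in> base_darts \<and> fst d \<in> X \<and> fst (base_mate d) \<notin> X}"
    using ps dart_path_crosses assms(2,3) by (intro card_disjoint_lists) (auto simp: list_all_iff)
  also have "\<dots> \<le> card {d \<in> base_darts. fst d \<in> X \<and> fst (base_mate d) \<notin> X}"
    by (intro card_mono) (auto simp: darts_def)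
  finally show ?thesis using ps(1) by simp
qed

text \<open>The pairs in \<open>links\<close> connect all big vertices, so \<open>X\<close>
  separates one of them. If its paths start outside \<open>X\<close>, they are used for the
  complement, and \<open>base_mate\<close> reverses the darts found.\<close>

lemma base_linked:
  assumes "X \<inter> {46..<58} \<noteq> {}" "{46..<58} - X \<noteq> {}"
  shows "4 \<le> card {d \<in> base_darts. fst d \<in> X \<and> fst (base_mate d) \<notin> X}"
proof -
  have "\<exists>(s, t, ps)\<in>set links. s \<in> X \<longleftrightarrow> t \<notin> X"
  proof (rule ccontr)
    assume "\<not> ?thesis"
    then have "\<forall>w\<in>set [46..<58]. w \<in> X \<longleftrightarrow> 46 \<in> X"
      by (auto simp: links_def upt_base)
    then have "\<forall>w\<in>{46..<58}. w \<in> X \<longleftrightarrow> 46 \<in> X" by (simp only: set_upt)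
    then show False using assms by blast
  qed
  then obtain s t ps where st: "(s, t, ps) \<in> set links" "s \<in> X \<longleftrightarrow> t \<notin> X" by auto
  show ?thesis
  proof (cases "s \<in> X")
    case True
    then show ?thesis using links_cross st by blast
  next
    case False
    have "4 \<le> card {d \<in> base_darts. fst d \<in> - X \<and> fst (base_mate d) \<notin> - X}"
      using links_cross[OF st(1), of "-X"] st(2) False by blast
    also have "\<dots> \<le> card {d \<in> base_darts. fst d \<in> X \<and> fst (base_mate d) \<notin> X}"
    proof (rule card_inj_on_le[where f = base_mate])
      have inv: "base_mate d \<in> base_darts \<and> base_mate (base_mate d) = d" if "d \<in> base_darts" for d
        using that by (rule base_mate_cases) auto
      then show "inj_on base_mate {d \<in> base_darts. fst d \<in> - X \<and> fst (base_mate d) \<notin> - X}"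
        by (intro inj_on_inverseI[where g = base_mate]) auto
      show "base_mate ` {d \<in> base_darts. fst d \<in> - X \<and> fst (base_mate d) \<notin> - X}
        \<subseteq> {d \<in> base_darts. fst d \<in> X \<and> fst (base_mate d) \<notin> X}"
        using inv by auto
      show "finite {d \<in> base_darts. fst d \<in> X \<and> fst (base_mate d) \<notin> X}"
        by (auto simp: darts_def)
    qed
    finally show ?thesis .
  qed
qed

text \<open>
  Nowhere-zero flows with values in the group of order four are pairs of Boolean flows.
  \<open>tree6\<close> and \<open>tree7\<close> are the flow conditions on the two kinds of trees of the base graph, which
  are the Petersen graph minus the ends of two edges and minus three vertices, respectively.
\<close>

definition tree6 :: "(nat \<Rightarrow> bool) \<Rightarrow> nat \<Rightarrow> bool" where
  "tree6 p i \<longleftrightarrow> p (i + 2) = (p i \<noteq> p (i + 1)) \<and> p (i + 5) = (p (i + 3) \<noteq> p (i + 4)) \<and>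
     p (i + 8) = (p (i + 6) \<noteq> p (i + 7)) \<and> p (i + 11) = (p (i + 9) \<noteq> p (i + 10)) \<and>
     p (i + 12) = (p i \<noteq> p (i + 6)) \<and> p (i + 12) = (p (i + 3) \<noteq> p (i + 9))"

definition tree7 :: "(nat \<Rightarrow> bool) \<Rightarrow> nat \<Rightarrow> bool" where
  "tree7 p i \<longleftrightarrow> p (i + 2) = (p i \<noteq> p (i + 1)) \<and> p (i + 5) = (p (i + 3) \<noteq> p (i + 4)) \<and>
     p (i + 7) = (p (i + 3) \<noteq> p (i + 6)) \<and> p (i + 10) = (p (i + 8) \<noteq> p (i + 9)) \<and>
     p (i + 12) = (p i \<noteq> p (i + 11)) \<and> p (i + 14) = (p (i + 8) \<noteq> p (i + 13)) \<and>
     p (i + 13) = (p (i + 6) \<noteq> p (i + 11))"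

text \<open>Flow between a tree and one end of a removed edge. In \<open>tree6\<close> the offset
  pairs 4, 7 and 1, 10 belong to one removed edge, 2, 5 and 8, 11 to the other.\<close>

definition sum2 :: "nat \<Rightarrow> nat \<Rightarrow> (nat \<Rightarrow> bool) \<Rightarrow> nat \<Rightarrow> bool" where
  "sum2 a b p i \<longleftrightarrow> p (i + a) \<noteq> p (i + b)"

text \<open>Flow between a tree and one removed vertex. In \<open>tree7\<close> the offsets 1, 7, 10
  belong to \<open>x\<close>, those 2, 5, 14 to \<open>y\<close>, and 4, 9, 12 to
  \<open>z\<close>.\<close>

definition sum3 :: "nat \<Rightarrow> nat \<Rightarrow> nat \<Rightarrow> (nat \<Rightarrow> bool) \<Rightarrow> nat \<Rightarrow> bool" where
  "sum3 a b c p i \<longleftrightarrow> (p (i + a) \<noteq> (p (i + b) \<noteq> p (i + c)))"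

text \<open>The total flow out of the tree vanishes, by adding up the conservation laws at its
  vertices.\<close>

lemma tree6_sum:
  "tree6 p i \<Longrightarrow> sum2 8 11 p i = (sum2 4 7 p i \<noteq> (sum2 1 10 p i \<noteq> sum2 2 5 p i))"
  unfolding tree6_def sum2_def by argo

lemma tree7_sum:
  "tree7 p i \<Longrightarrow> sum3 4 9 12 p i = (sum3 1 7 10 p i \<noteq> sum3 2 5 14 p i)"
  unfolding tree7_def sum3_def by argo

text \<open>With the common non-zero values on the two removed edges, this would be a nowhere-zero
  flow on the Petersen graph.\<close>

lemma tree6_no_two_flows:
  assumes "tree6 p i" "tree6 q i" and nz: "\<And>e. p e \<or> q e"
    and "sum2 4 7 p i = sum2 1 10 p i" "sum2 4 7 q i = sum2 1 10 q i"
    and "sum2 2 5 p i = sum2 8 11 p i" "sum2 2 5 q i = sum2 8 11 q i"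
    and "sum2 4 7 p i \<or> sum2 4 7 q i" "sum2 2 5 p i \<or> sum2 2 5 q i"
  shows False
  using assms(1,2,4-) nz[of i] nz[of "i + 1"] nz[of "i + 2"] nz[of "i + 3"] nz[of "i + 4"]
    nz[of "i + 5"] nz[of "i + 6"] nz[of "i + 7"] nz[of "i + 8"] nz[of "i + 9"] nz[of "i + 10"]
    nz[of "i + 11"] nz[of "i + 12"]
  unfolding tree6_def sum2_def by argo

text \<open>Zero sums at \<open>x\<close> and \<open>y\<close>, hence also at \<open>z\<close> by
  \<open>tree7_sum\<close>, would make this a nowhere-zero flow on the whole Petersen graph.\<close>

lemma tree7_some_flow:
  assumes "tree7 p i" "tree7 q i" and nz: "\<And>e. p e \<or> q e"
    and "\<not> sum3 1 7 10 p i" "\<not> sum3 1 7 10 q i" "\<not> sum3 2 5 14 p i" "\<not> sum3 2 5 14 q i"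
  shows False
  using assms(1,2,4-) nz[of i] nz[of "i + 1"] nz[of "i + 2"] nz[of "i + 3"] nz[of "i + 4"]
    nz[of "i + 5"] nz[of "i + 6"] nz[of "i + 7"] nz[of "i + 8"] nz[of "i + 9"] nz[of "i + 10"]
    nz[of "i + 11"] nz[of "i + 12"] nz[of "i + 13"] nz[of "i + 14"]
  unfolding tree7_def sum3_def by argo

lemma even_filter3: "even (length (filter p [a, b, c])) \<longleftrightarrow> p c = (p a \<noteq> p b)"
  by auto

lemma even_filter5:
  "even (length (filter p [a, b, c, d, e])) \<longleftrightarrow> \<not> (p a \<noteq> (p b \<noteq> (p c \<noteq> (p d \<noteq> p e))))"
  by auto

text \<open>Conservation at the vertices of degree three gives the tree conditions. At a vertex of
  degree five it equates the flows of the two connectors that meet there.\<close>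

lemma incidence_flow:
  assumes "\<forall>w<58. even (length (filter p (incidence ! w)))"
  shows "tree6 p 0" "tree6 p 13" "tree6 p 26" "tree7 p 39" "tree7 p 54" "tree7 p 69" "tree7 p 84"
    and "sum2 4 7 p 0 = sum3 4 9 12 p 39" "sum2 1 10 p 0 = sum3 4 9 12 p 54"
    and "sum2 2 5 p 0 = sum3 4 9 12 p 69" "sum2 8 11 p 0 = sum3 4 9 12 p 84"
    and "sum2 4 7 p 13 = sum3 1 7 10 p 39" "sum2 1 10 p 13 = sum3 2 5 14 p 39"
    and "sum2 2 5 p 13 = sum3 1 7 10 p 54" "sum2 8 11 p 13 = sum3 2 5 14 p 54"
    and "sum2 4 7 p 26 = sum3 1 7 10 p 69" "sum2 1 10 p 26 = sum3 2 5 14 p 69"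
    and "sum2 2 5 p 26 = sum3 1 7 10 p 84" "sum2 8 11 p 26 = sum3 2 5 14 p 84"
proof -
  have "list_all (\<lambda>is. even (length (filter p is))) incidence"
    using assms by (simp add: list_all_length) (simp add: incidence_def)
  note eqs = this[unfolded incidence_def list.pred_inject even_filter3 even_filter5]
  note to_numeral = tree6_def tree7_def sum2_def sum3_def add_0 arith_simps numeral_plus_one
  show "tree6 p 0" "tree6 p 13" "tree6 p 26" "tree7 p 39" "tree7 p 54" "tree7 p 69" "tree7 p 84"
    unfolding to_numeral using eqs by argo+
  show "sum2 4 7 p 0 = sum3 4 9 12 p 39" "sum2 1 10 p 0 = sum3 4 9 12 p 54"
    "sum2 2 5 p 0 = sum3 4 9 12 p 69" "sum2 8 11 p 0 = sum3 4 9 12 p 84"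
    "sum2 4 7 p 13 = sum3 1 7 10 p 39" "sum2 1 10 p 13 = sum3 2 5 14 p 39"
    "sum2 2 5 p 13 = sum3 1 7 10 p 54" "sum2 8 11 p 13 = sum3 2 5 14 p 54"
    "sum2 4 7 p 26 = sum3 1 7 10 p 69" "sum2 1 10 p 26 = sum3 2 5 14 p 69"
    "sum2 2 5 p 26 = sum3 1 7 10 p 84" "sum2 8 11 p 26 = sum3 2 5 14 p 84"
    unfolding to_numeral using eqs by argo+
qed

lemma no_nowhere_zero_flow:
  assumes p: "\<forall>w<58. even (length (filter p (incidence ! w)))"
    and q: "\<forall>w<58. even (length (filter q (incidence ! w)))"
    and nz: "\<And>e. p e \<or> q e"
  shows False
proof -
  note fp = incidence_flow[of p, OF p] and fq = incidence_flow[of q, OF q]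
  \<comment> \<open>A superedge with middle tree \<open>d\<close> and end trees \<open>i\<close> and
    \<open>j\<close>. Vanishing of the total flows makes the flows at both places of
    \<open>z\<close> equal. Were they zero, the flows at \<open>x\<close> and \<open>y\<close> of
    each end tree would agree and be non-zero, so both removed edges of the middle tree would carry
    non-zero flow.\<close>
  have "sum3 4 9 12 p i = sum3 4 9 12 p j \<and> sum3 4 9 12 q i = sum3 4 9 12 q j \<and>
      (sum3 4 9 12 p i \<or> sum3 4 9 12 q i)"
    if t: "tree6 p d" "tree7 p i" "tree7 p j" "tree6 q d" "tree7 q i" "tree7 q j"
      and b: "sum2 4 7 p d = sum3 1 7 10 p i" "sum2 1 10 p d = sum3 2 5 14 p i"
        "sum2 2 5 p d = sum3 1 7 10 p j" "sum2 8 11 p d = sum3 2 5 14 p j"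
        "sum2 4 7 q d = sum3 1 7 10 q i" "sum2 1 10 q d = sum3 2 5 14 q i"
        "sum2 2 5 q d = sum3 1 7 10 q j" "sum2 8 11 q d = sum3 2 5 14 q j" for d i j
    using tree6_sum[OF t(1)] tree6_sum[OF t(4)] tree7_sum[OF t(2)] tree7_sum[OF t(3)]
      tree7_sum[OF t(5)] tree7_sum[OF t(6)] tree7_some_flow[OF t(2,5) nz]
      tree7_some_flow[OF t(3,6) nz] tree6_no_two_flows[OF t(1,4) nz] b
    by argo
  \<comment> \<open>Both superedges carry non-zero flow, so the tree at offset 0 completes to the
    Petersen graph with a nowhere-zero flow.\<close>
  note F = this[OF fp(2,4,5) fq(2,4,5) fp(12-15) fq(12-15)]
    this[OF fp(3,6,7) fq(3,6,7) fp(16-19) fq(16-19)]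
  then show False
    using tree6_no_two_flows[OF fp(1) fq(1) nz] fp(8-11) fq(8-11) by argo
qed

lemma odd_cards_parity:
  assumes "odd (card {k \<in> {..<5}. f k = a})"
  shows "even (length (filter (\<lambda>k. f k \<noteq> a) [0..<5]))"
proof -
  have "length (filter (\<lambda>k. f k = a) [0..<5]) = card {k \<in> {..<5}. f k = a}"
    by (subst distinct_length_filter) (auto intro: arg_cong[where f = card])
  moreover have "length (filter (\<lambda>k. f k = a) [0..<5]) + length (filter (\<lambda>k. f k \<noteq> a) [0..<5]) = 5"
    using sum_length_filter_compl[of "\<lambda>k. f k = a" "[0..<5]"] by simp
  ultimately show ?thesis using assms by presburger
qed

lemma distinct_parity:
  assumes "inj_on f {..<3 :: nat}" "\<And>k. k < 3 \<Longrightarrow> f k < (3 :: nat)" "a < 3"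
  shows "even (length (filter (\<lambda>k. f k \<noteq> a) [0..<3]))"
proof -
  have "f ` {..<3} = {..<3}"
    using assms(1,2) by (intro card_subset_eq) (auto simp: card_image)
  then obtain k where k: "k < 3" "f k = a" using assms(3) by (metis imageE lessThan_iff)
  have "length (filter (\<lambda>k. f k = a) [0..<3]) = card {j \<in> {..<3}. f j = a}"
    by (subst distinct_length_filter) (auto intro: arg_cong[where f = card])
  also have "{j \<in> {..<3}. f j = a} = {k}"
    using assms(1) k by (auto simp: inj_on_def)
  finally have "length (filter (\<lambda>k. f k = a) [0..<3]) = 1" by simp
  then show ?thesis
    using sum_length_filter_compl[of "\<lambda>k. f k = a" "[0..<3]"] by simp
qed

lemma base_no_flow:
  assumes c: "\<And>d. d \<in> base_darts \<Longrightarrow> c d < (3 :: nat) \<and> c (base_mate d) = c d"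
    and small: "\<And>w. w \<in> {..<46} \<Longrightarrow> inj_on (\<lambda>k. c (w, k)) {..<3}"
    and big: "\<And>w a. \<lbrakk>w \<in> {46..<58}; a < 3\<rbrakk> \<Longrightarrow> odd (card {k \<in> {..<5}. c (w, k) = a})"
  shows False
proof -
  define f where "f e = c (fst (edge_darts ! e))" for e
  have fc: "f (edge_of d) = c d" if "d \<in> base_darts" for d
    using that
  proof (rule base_mate_cases)
    fix d1 d2 assume d: "d1 \<in> base_darts" "d2 \<in> base_darts" "edge_of d1 = edge_of d" "edge_of d2 = edge_of d"
      "base_mate d1 = d2" "base_mate d2 = d1" "d = d1 \<or> d = d2"
    have "c d1 = c d2" using c[OF d(1)] d(5) by simp
    moreover have "fst (edge_darts ! edge_of d) = d1 \<or> fst (edge_darts ! edge_of d) = d2"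
      using d(3,5) by (auto simp: base_mate_def split: prod.splits if_splits)
    ultimately show ?thesis using d(7) by (auto simp: f_def)
  qed
  have lens: "list_all (\<lambda>es. length es = 3) (take 46 incidence)"
    "list_all (\<lambda>es. length es = 5) (drop 46 incidence)"
    by (simp_all add: incidence_def)
  have len: "length incidence = 58" by (simp add: incidence_def)
  have par: "even (length (filter (\<lambda>e. f e \<noteq> a) (incidence ! w)))" if w: "w < 58" and a: "a < 3" for w a
  proof (cases "w < 46")
    case True
    then have "length (incidence ! w) = 3"
      using lens(1) len by (auto simp: list_all_length)
    then have "incidence ! w = map (\<lambda>k. edge_of (w, k)) [0..<3]"
      by (auto simp: edge_of_def intro: nth_equalityI)
    moreover have "f (edge_of (w, k)) = c (w, k)" if "k < 3" for k
      using that True by (intro fc) (auto simp: darts_def)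
    ultimately have "length (filter (\<lambda>e. f e \<noteq> a) (incidence ! w)) = length (filter (\<lambda>k. c (w, k) \<noteq> a) [0..<3])"
      by (auto simp: filter_map comp_def intro!: arg_cong[where f = length] filter_cong)
    then show ?thesis
      using distinct_parity[OF small[of w], of a] c True a by (auto simp: darts_def)
  next
    case False
    then have "length (incidence ! w) = 5"
      using lens(2)[unfolded list_all_length, rule_format, of "w - 46"] len w by simp
    then have "incidence ! w = map (\<lambda>k. edge_of (w, k)) [0..<5]"
      by (auto simp: edge_of_def intro: nth_equalityI)
    moreover have "f (edge_of (w, k)) = c (w, k)" if "k < 5" for k
      using that False w by (intro fc) (auto simp: darts_def)
    ultimately have "length (filter (\<lambda>e. f e \<noteq> a) (incidence ! w)) = length (filter (\<lambda>k. c (w, k) \<noteq> a) [0..<5])"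
      by (auto simp: filter_map comp_def intro!: arg_cong[where f = length] filter_cong)
    then show ?thesis using odd_cards_parity big[of w a] False w a by simp
  qed
  \<comment> \<open>The colours 0, 1, 2 become the non-zero pairs (0, 1), (1, 0), (1, 1) of bits: no
    colour equals both 0 and 1.\<close>
  show False
    using no_nowhere_zero_flow[of "\<lambda>e. f e \<noteq> 0" "\<lambda>e. f e \<noteq> 1"] par by force
qed

lemma base_colour_small:
  assumes "w < 46" "w \<noteq> 4" "w \<noteq> 5"
  shows "inj_on (\<lambda>k. base_colour (w, k)) {..<3}"
proof -
  have all: "list_all (\<lambda>w. w = 4 \<or> w = 5 \<or> distinct (map (\<lambda>k. base_colour (w, k)) [0..<3])) [0..<46]"
    by (simp add: upt_base incidence_def edge_colours_def base_colour_def edge_of_def)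
  then have "distinct (map (\<lambda>k. base_colour (w, k)) [0..<3])"
    using all[unfolded list_all_upt, rule_format, of w] assms by blast
  then show ?thesis by (simp add: distinct_map atLeast0LessThan)
qed

lemma base_colour_big:
  assumes "46 \<le> w" "w < 58"
  shows "base_colour (w, 2) = base_colour (w, 0)" "base_colour (w, 4) = base_colour (w, 0)"
    "inj_on (\<lambda>k. base_colour (w, k)) {0, 1, 3}"
proof -
  have all: "list_all (\<lambda>w. base_colour (w, 2) = base_colour (w, 0) \<and> base_colour (w, 4) = base_colour (w, 0) \<and>
     distinct (map (\<lambda>k. base_colour (w, k)) [0, 1, 3])) [46..<58]"
    by (simp add: upt_base incidence_def edge_colours_def base_colour_def edge_of_def)
  have "base_colour (w, 2) = base_colour (w, 0) \<and> base_colour (w, 4) = base_colour (w, 0) \<and>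
     distinct (map (\<lambda>k. base_colour (w, k)) [0, 1, 3])"
    using all[unfolded list_all_upt, rule_format, of w] assms by blast
  then show "base_colour (w, 2) = base_colour (w, 0)" "base_colour (w, 4) = base_colour (w, 0)"
    "inj_on (\<lambda>k. base_colour (w, k)) {0, 1, 3}" by (auto simp: inj_on_def)
qed

theorem base_graph_base: "base_graph {..<46} {46..<58} base_mate 4 5 base_colour"
proof
  show "finite {..<46 :: nat}" "finite {46..<58 :: nat}" "{..<46} \<inter> {46..<58 :: nat} = {}" by auto
  fix d assume d: "d \<in> base_darts"
  show "base_mate d \<in> base_darts" "base_mate (base_mate d) = d" "fst (base_mate d) \<noteq> fst d"
    "base_colour (base_mate d) = base_colour d"
    using d by (rule base_mate_cases; auto simp: base_colour_def)+
  show "fst (base_mate d) \<in> {..<46}" if "fst d \<in> {46..<58}"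
    by (rule base_mate_cases[OF d]) (use that in auto)
  have "list_all (\<lambda>x. x < 3) edge_colours" "length edge_colours = 99" by (simp_all add: edge_colours_def)
  then show "base_colour d < 3"
    using base_dart_edge(1)[OF d] by (simp add: base_colour_def list_all_length)
next
  \<comment> \<open>Dart \<open>(4, 2)\<close> belongs to edge 12, the middle edge of the first
    tree.\<close>
  show "\<exists>k<3. fst (base_mate (4, k)) = 5"
    by (rule exI[of _ 2]) (simp add: base_mate_def edge_of_def incidence_def edge_darts_def)
  show False if "\<And>d. d \<in> base_darts \<Longrightarrow> c d < 3 \<and> c (base_mate d) = c d"
    "\<And>w. w \<in> {..<46} \<Longrightarrow> inj_on (\<lambda>k. c (w, k)) {..<3}"
    "\<And>w a. \<lbrakk>w \<in> {46..<58}; a < 3\<rbrakk> \<Longrightarrow> odd (card {k \<in> {..<5}. c (w, k) = a})"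
    for c :: "nat \<times> nat \<Rightarrow> nat"
    by (rule base_no_flow[OF that])
qed (use base_forest base_linked base_colour_small base_colour_big in auto)

theorem theorem5p2:
  fixes g :: int
  shows "\<exists>(G :: (nat, nat) multigraph) u v.
           nontrivial_snark G \<and> girth G \<ge> enat (nat g) \<and>
           u \<noteq> v \<and> adjacent G u v \<and> non_removable G {u, v}"
proof -
  \<comment> \<open>With 46 small and 12 big vertices, \<open>large_girth_snark\<close> needs
    \<open>L\<close> to be at least 46 + 36 + 6 = 88, and \<open>L - 1\<close> has to reach
    \<open>nat g\<close>.\<close>
  define L where "L = nat g + 100"
  obtain V E n where host: "coloured_host (V :: (nat list \<Rightarrow> nat list) set) E n L"
    using coloured_host_exists by blast
  interpret blowup "{..<46}" "{46..<58}" base_mate 4 5 base_colour V E n L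
    using base_graph_base host by (rule blowup.intro)
  obtain G :: "(nat, nat) multigraph" and u v where G: "nontrivial_snark G" "enat (L - 1) \<le> girth G"
      "u \<noteq> v" "adjacent G u v" "non_removable G {u, v}"
    using large_girth_snark by (auto simp: L_def)
  have "enat (nat g) \<le> enat (L - 1)" by (simp add: L_def)
  then have "enat (nat g) \<le> girth G" using G(2) by (rule order.trans)
  then show ?thesis using G by blast
qed

end
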